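(* Let $p=p(n)$ satisfy $n^{-0.4} \le p < 1$. Then with probability tending to $1$ as $n\to\infty$, the random graph $G(n,p)$ satisfies $$\mathrm{PSD}[G(n,p)] \ge \frac{np}{200 \log n}.$$
   Context: $G(n,p)$ is the Erdős–Rényi random graph on $n$ labeled vertices where each pair is an edge independently with probability $p$. Let $G$ be a graph. A separating family of $G$ is a multiset $\mathcal{F}$ of total orders of $V(G)$ such that for any two disjoint edges $e,f$ of $G$ there is at least one element of $\mathcal{F}$ in which all vertices of one of the edges precede all vertices of the other. It is perfect if there is a positive integer $\lambda$ such that every pair of disjoint edges is separated in this sense by exactly $\lambda$ members of $\mathcal{F}$ (counted with multiplicity). $\mathrm{PSD}(G)$ is the smallest size of a perfect separating family of $G$. $\log=\log_2$. *)

theory Defs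
  imports "HOL-Probability.Probability" "HOL-Library.Multiset"
begin

text \<open>A finite simple graph is given by a vertex set \<open>V\<close> and a set \<open>E\<close> of two-element
  subsets of \<open>V\<close>.\<close>

definition vertex_pairs :: "'a set \<Rightarrow> 'a set set" where
  "vertex_pairs V = {e. e \<subseteq> V \<and> card e = 2}"

definition gnp_pmf :: "nat \<Rightarrow> real \<Rightarrow> nat set set pmf" where
  "gnp_pmf n p =
     map_pmf (\<lambda>X. {e \<in> vertex_pairs {..<n}. X e})
       (Pi_pmf (vertex_pairs {..<n}) False (\<lambda>_. bernoulli_pmf p))"

definition all_precede :: "('a \<times> 'a) set \<Rightarrow> 'a set \<Rightarrow> 'a set \<Rightarrow> bool" where
  "all_precede r e f \<longleftrightarrow> (\<forall>x\<in>e. \<forall>y\<in>f. (x, y) \<in> r \<and> x \<noteq> y)"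

definition separates :: "('a \<times> 'a) set \<Rightarrow> 'a set \<Rightarrow> 'a set \<Rightarrow> bool" where
  "separates r e f \<longleftrightarrow> all_precede r e f \<or> all_precede r f e"

definition separating_family ::
    "'a set \<Rightarrow> 'a set set \<Rightarrow> ('a \<times> 'a) set multiset \<Rightarrow> bool" where
  "separating_family V E F \<longleftrightarrow>
     (\<forall>r \<in># F. linear_order_on V r) \<and>
     (\<forall>e\<in>E. \<forall>f\<in>E. e \<inter> f = {} \<longrightarrow> (\<exists>r \<in># F. separates r e f))"

definition perfect_separating_family ::
    "'a set \<Rightarrow> 'a set set \<Rightarrow> ('a \<times> 'a) set multiset \<Rightarrow> bool" where
  "perfect_separating_family V E F \<longleftrightarrow>
     separating_family V E F \<and>
     (\<exists>l::nat. l > 0 \<and>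
        (\<forall>e\<in>E. \<forall>f\<in>E. e \<inter> f = {} \<longrightarrow> size (filter_mset (\<lambda>r. separates r e f) F) = l))"

text \<open>The minimum is attained for every finite simple graph: by symmetry, the family of all
  total orders of \<open>V\<close>, each taken once, is perfect.\<close>

definition PSD :: "'a set \<Rightarrow> 'a set set \<Rightarrow> nat" where
  "PSD V E = (LEAST k. \<exists>F. perfect_separating_family V E F \<and> size F = k)"

end

theory Submission
  imports Defs "HOL-Real_Asymp.Real_Asymp" "HOL-Library.Function_Algebras"
begin

text \<open>The proof is a union bound over all families of \<open>k < n p / (200 log n)\<close> linear orders, of which
  there are at most \<open>n ^ (n k)\<close>, that is \<open>2 ^ (n\<^sup>2 p / 200)\<close>. It remains to see that a fixed family is
  perfect for \<open>G(n, p)\<close> with a fixed \<open>l > 0\<close> with probability at most \<open>exp (n / 8 - 0.0046 n\<^sup>2 p)\<close>. Call two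
  disjoint vertex pairs in conflict if they are not separated exactly \<open>l\<close> times; the edge set must then
  be an independent set of the conflict graph.

  Every order separates exactly one of the three perfect matchings of a 4-set. If \<open>3 l \<noteq> k\<close>, every
  4-set therefore contains a conflict. If \<open>3 l = k\<close>, fix \<open>u\<close> and \<open>v\<close>, and consider those vertices \<open>x\<close>
  that lie outside the interval between \<open>u\<close> and \<open>v\<close> in a number of orders other than \<open>l\<close>; on average
  these are at least two thirds of all vertices. A rank argument shows that among any \<open>2 k + 2\<close> of them
  there are \<open>x\<close> and \<open>y\<close> such that \<open>{u, x}\<close> and \<open>{v, y}\<close> are in conflict. Maximum matchings for all \<open>u\<close>
  and \<open>v\<close> combine to a conflict graph with on the order of \<open>n\<^sup>3\<close> pairs and maximum degree \<open>4 n\<close>.\<close>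

subsection \<open>Random independent sets\<close>

definition independent_sets :: "('a \<times> 'a) set \<Rightarrow> 'a set set" where
  "independent_sets R = {A. R \<inter> A \<times> A = {}}"

lemma independent_sets_antimono: "R \<subseteq> R' \<Longrightarrow> independent_sets R' \<subseteq> independent_sets R"
  by (auto simp: independent_sets_def)

definition random_subset_pmf :: "'a set \<Rightarrow> real \<Rightarrow> 'a set pmf" where
  "random_subset_pmf S p = map_pmf (\<lambda>X. {x \<in> S. X x}) (Pi_pmf S False (\<lambda>_. bernoulli_pmf p))"

lemma set_pmf_random_subset_pmf: "set_pmf (random_subset_pmf S p) \<subseteq> Pow S"
  by (auto simp: random_subset_pmf_def)

lemma prob_random_subset_pmf_cong:
  assumes "\<And>A. A \<subseteq> S \<Longrightarrow> A \<in> \<A> \<longleftrightarrow> A \<in> \<B>"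
  shows "measure_pmf.prob (random_subset_pmf S p) \<A> = measure_pmf.prob (random_subset_pmf S p) \<B>"
  using assms set_pmf_random_subset_pmf[of S p]
  by (intro measure_prob_cong_0) (auto simp: set_pmf_iff)

lemma random_subset_pmf_Un:
  assumes "finite S" "finite T" "S \<inter> T = {}"
  shows "random_subset_pmf (S \<union> T) p =
    map_pmf (\<lambda>(A, B). A \<union> B) (pair_pmf (random_subset_pmf S p) (random_subset_pmf T p))"
proof -
  have "{x \<in> S \<union> T. if x \<in> S then f x else g x} = {x \<in> S. f x} \<union> {x \<in> T. g x}" for f g :: "'a \<Rightarrow> bool"
    using assms(3) by auto
  then show ?thesis
    unfolding random_subset_pmf_def Pi_pmf_union[OF assms]
    by (simp add: pmf.map_comp pair_map_pmf1 pair_map_pmf2 o_def case_prod_unfold)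
qed

lemma prob_random_subset_pmf_Un:
  assumes "finite S" "finite T" "S \<inter> T = {}"
  shows "measure_pmf.prob (random_subset_pmf (S \<union> T) p) {A. A \<inter> S \<in> \<A> \<and> A \<inter> T \<in> \<B>} =
    measure_pmf.prob (random_subset_pmf S p) \<A> * measure_pmf.prob (random_subset_pmf T p) \<B>"
proof -
  let ?M = "random_subset_pmf S p" and ?N = "random_subset_pmf T p"
  have "measure_pmf.prob (random_subset_pmf (S \<union> T) p) {A. A \<inter> S \<in> \<A> \<and> A \<inter> T \<in> \<B>} =
      measure_pmf.prob (pair_pmf ?M ?N) {(A, B). (A \<union> B) \<inter> S \<in> \<A> \<and> (A \<union> B) \<inter> T \<in> \<B>}"
    by (simp add: random_subset_pmf_Un[OF assms] vimage_def case_prod_unfold)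
  also have "\<dots> = measure_pmf.prob (pair_pmf ?M ?N) ((\<A> \<inter> Pow S) \<times> (\<B> \<inter> Pow T))"
  proof (rule measure_pmf.finite_measure_eq_AE)
    have "(A \<union> B) \<inter> S = A" "(A \<union> B) \<inter> T = B" if "A \<subseteq> S" "B \<subseteq> T" for A B
      using that assms(3) by auto
    then show "AE q in pair_pmf ?M ?N. q \<in> {(A, B). (A \<union> B) \<inter> S \<in> \<A> \<and> (A \<union> B) \<inter> T \<in> \<B>} \<longleftrightarrow>
        q \<in> (\<A> \<inter> Pow S) \<times> (\<B> \<inter> Pow T)"
      using set_pmf_random_subset_pmf[of S p] set_pmf_random_subset_pmf[of T p]
      by (auto simp: AE_measure_pmf_iff subset_iff Pow_def)
  qed auto
  also have "\<dots> = measure_pmf.prob ?M (\<A> \<inter> Pow S) * measure_pmf.prob ?N (\<B> \<inter> Pow T)"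
    using assms by (intro measure_pmf_prob_product countable_finite) auto
  also have "\<dots> = measure_pmf.prob ?M \<A> * measure_pmf.prob ?N \<B>"
    by (intro arg_cong2[of _ _ _ _ "(*)"] prob_random_subset_pmf_cong) auto
  finally show ?thesis .
qed

lemma pmf_random_subset_pmf:
  assumes p: "0 \<le> p" "p \<le> 1" and S: "finite S" and A: "A \<subseteq> S"
  shows "pmf (random_subset_pmf S p) A = p ^ card A * (1 - p) ^ card (S - A)"
proof -
  have "(\<lambda>X. {x \<in> S. X x}) -` {A} = Pi S (\<lambda>x. {x \<in> A})"
    using A by auto
  then have "pmf (random_subset_pmf S p) A = (\<Prod>x\<in>S. pmf (bernoulli_pmf p) (x \<in> A))"
    using S by (simp add: random_subset_pmf_def pmf_map measure_Pi_pmf_Pi measure_pmf_single)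
  also have "\<dots> = (\<Prod>x\<in>S - A. pmf (bernoulli_pmf p) (x \<in> A)) * (\<Prod>x\<in>A. pmf (bernoulli_pmf p) (x \<in> A))"
    by (rule prod.subset_diff[OF A S])
  also have "(\<Prod>x\<in>S - A. pmf (bernoulli_pmf p) (x \<in> A)) = (\<Prod>x\<in>S - A. 1 - p)"
    using p by (intro prod.cong) auto
  also have "(\<Prod>x\<in>A. pmf (bernoulli_pmf p) (x \<in> A)) = (\<Prod>x\<in>A. p)"
    using p by (intro prod.cong) auto
  finally show ?thesis by simp
qed

lemma prob_independent_remove_vertex:
  assumes p: "0 \<le> p" "p \<le> 1" and S: "finite S" "v \<in> S" and R: "sym R" "irrefl R"
  defines "N \<equiv> R `` {v} \<inter> S"
  defines "q \<equiv> \<lambda>T. measure_pmf.prob (random_subset_pmf T p) (independent_sets R)"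
  shows "q S = (1 - p) * q (S - {v}) + p * (1 - p) ^ card N * q (S - insert v N)"
proof -
  let ?M = "random_subset_pmf S p" and ?T = "S - insert v N" and ?I = "independent_sets R"
  have N: "N \<subseteq> S" "v \<notin> N" "finite N"
    using S R by (auto simp: N_def irrefl_def)
  have avoid: "measure_pmf.prob ?M {A \<in> ?I. v \<notin> A} = (1 - p) * q (S - {v})"
  proof -
    have "measure_pmf.prob ?M {A \<in> ?I. v \<notin> A} =
        measure_pmf.prob ?M {A. A \<inter> {v} \<in> {{}} \<and> A \<inter> (S - {v}) \<in> ?I}"
      by (rule prob_random_subset_pmf_cong) (auto simp: independent_sets_def)
    then show ?thesis
      using prob_random_subset_pmf_Un[of "{v}" "S - {v}" p "{{}}" ?I] S p
      by (simp add: insert_absorb measure_pmf_single pmf_random_subset_pmf q_def)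
  qed
  have contain: "measure_pmf.prob ?M {A \<in> ?I. v \<in> A} = p * (1 - p) ^ card N * q ?T"
  proof -
    have "measure_pmf.prob ?M {A \<in> ?I. v \<in> A} =
        measure_pmf.prob ?M {A. A \<inter> insert v N \<in> {{v}} \<and> A \<inter> ?T \<in> ?I}"
    proof (rule prob_random_subset_pmf_cong)
      fix A assume "A \<subseteq> S"
      then have "A \<in> ?I \<longleftrightarrow> A \<inter> N = {} \<and> A \<inter> ?T \<in> ?I" if "v \<in> A"
        using R that unfolding independent_sets_def N_def sym_def irrefl_def by blast
      moreover have "A \<inter> insert v N \<in> {{v}} \<longleftrightarrow> v \<in> A \<and> A \<inter> N = {}"
        using N(2) by auto
      ultimately show "A \<in> {A \<in> ?I. v \<in> A} \<longleftrightarrow> A \<in> {A. A \<inter> insert v N \<in> {{v}} \<and> A \<inter> ?T \<in> ?I}"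
        by blast
    qed
    moreover have "insert v N \<union> ?T = S" using N S by auto
    ultimately show ?thesis
      using prob_random_subset_pmf_Un[of "insert v N" ?T p "{{v}}" ?I] S p N
      by (simp add: measure_pmf_single pmf_random_subset_pmf q_def)
  qed
  have "q S = measure_pmf.prob ?M ({A \<in> ?I. v \<notin> A} \<union> {A \<in> ?I. v \<in> A})"
    unfolding q_def by (rule prob_random_subset_pmf_cong) auto
  also have "\<dots> = measure_pmf.prob ?M {A \<in> ?I. v \<notin> A} + measure_pmf.prob ?M {A \<in> ?I. v \<in> A}"
    by (intro measure_pmf.finite_measure_Union) auto
  finally show ?thesis by (simp only: avoid contain)
qed

lemma branching_factor_le_1:
  fixes p :: real
  assumes p: "0 \<le> p" "p \<le> 1" and d: "4 \<le> p * real d"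
  shows "(1 - p) * exp (p / 2) + p * (1 - p) ^ d * exp (p / 2 * (real d + 1)) \<le> 1"
proof -
  have "2 * exp (- 2) \<le> (1 :: real)"
    using exp_ge_add_one_self[of "2 :: real"] by (simp add: exp_minus field_simps)
  then have exp_neg_2: "exp (- 2) \<le> (1 / 2 :: real)" by simp
  have "(1 - p) ^ d \<le> exp (- p) ^ d"
    using p exp_ge_add_one_self[of "- p"] by (intro power_mono) auto
  also have "\<dots> = exp (- (p * real d))"
    by (simp add: exp_of_nat_mult[symmetric] mult.commute)
  finally have "(1 - p) ^ d * exp (p / 2 * (real d + 1)) \<le> exp (- (p * real d)) * exp (p / 2 * (real d + 1))"
    by (intro mult_right_mono) auto
  also have "\<dots> = exp (- (p * real d / 2)) * exp (p / 2)"
    by (simp add: exp_add[symmetric] field_simps)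
  also have "\<dots> \<le> exp (- 2) * exp (p / 2)"
    using d by (intro mult_right_mono) auto
  also have "\<dots> \<le> 1 / 2 * exp (p / 2)"
    using exp_neg_2 by (intro mult_right_mono) auto
  finally have "p * ((1 - p) ^ d * exp (p / 2 * (real d + 1))) \<le> p * (1 / 2 * exp (p / 2))"
    using p by (intro mult_left_mono) auto
  then have "(1 - p) * exp (p / 2) + p * (1 - p) ^ d * exp (p / 2 * (real d + 1)) \<le> (1 - p / 2) * exp (p / 2)"
    by (simp add: algebra_simps)
  also have "\<dots> \<le> exp (- (p / 2)) * exp (p / 2)"
    using exp_ge_add_one_self[of "- (p / 2)"] by (intro mult_right_mono) auto
  finally show ?thesis by (simp add: exp_add[symmetric])
qed

lemma card_Int_square_Diff_ge:
  assumes S: "finite S" and X: "finite X" and R: "sym R"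
    and deg: "\<And>x. x \<in> X \<Longrightarrow> card (R `` {x} \<inter> S) \<le> D"
  shows "card (R \<inter> S \<times> S) \<le> card (R \<inter> (S - X) \<times> (S - X)) + 2 * D * card X"
proof -
  let ?rest = "R \<inter> (S - X) \<times> (S - X)" and ?star = "SIGMA x:X. R `` {x} \<inter> S"
  have fin: "finite ?rest" "finite ?star" using S X by auto
  have "card ?star \<le> D * card X"
    using sum_bounded_above[of X "\<lambda>x. card (R `` {x} \<inter> S)" D] deg S X by (simp add: mult.commute)
  moreover have "card (?star\<inverse>) = card ?star" by (rule card_inverse)
  moreover have "R \<inter> S \<times> S \<subseteq> ?rest \<union> (?star \<union> ?star\<inverse>)"
    using R by (auto simp: sym_def)
  then have "card (R \<inter> S \<times> S) \<le> card (?rest \<union> (?star \<union> ?star\<inverse>))"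
    using fin by (intro card_mono) auto
  ultimately show ?thesis
    using card_Un_le[of ?rest "?star \<union> ?star\<inverse>"] card_Un_le[of ?star "?star\<inverse>"] by linarith
qed

lemma exists_large_degree:
  fixes c :: real
  assumes "finite S" "c * card S < card (R \<inter> S \<times> S)"
  shows "\<exists>v\<in>S. c \<le> card (R `` {v} \<inter> S)"
proof (rule ccontr)
  assume "\<not> ?thesis"
  then have "real (card (R `` {v} \<inter> S)) \<le> c" if "v \<in> S" for v using that by force
  then have "(\<Sum>v\<in>S. real (card (R `` {v} \<inter> S))) \<le> c * card S"
    using sum_bounded_above[of S "\<lambda>v. real (card (R `` {v} \<inter> S))" c] by (simp add: mult.commute)
  moreover have "R \<inter> S \<times> S = (SIGMA v:S. R `` {v} \<inter> S)" by auto
  ultimately show False using assms by simp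
qed

definition independence_exponent :: "real \<Rightarrow> nat \<Rightarrow> ('a \<times> 'a) set \<Rightarrow> 'a set \<Rightarrow> real" where
  "independence_exponent p D R S = real (card S) / D - p * real (card (R \<inter> S \<times> S)) / (4 * D)"

lemma independence_exponent_Diff_le:
  assumes p: "0 \<le> p" and D: "D > 0" and S: "finite S" "X \<subseteq> S" and R: "sym R"
    and deg: "\<And>x. x \<in> X \<Longrightarrow> card (R `` {x} \<inter> S) \<le> D"
  shows "independence_exponent p D R (S - X) \<le> independence_exponent p D R S + p / 2 * card X"
proof -
  let ?lost = "2 * D * card X"
  have "card (R \<inter> S \<times> S) \<le> card (R \<inter> (S - X) \<times> (S - X)) + ?lost"
    using S R deg by (intro card_Int_square_Diff_ge finite_subset[OF S(2)]) auto
  then have "p * real (card (R \<inter> S \<times> S)) / (4 * D)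
      \<le> p * real (card (R \<inter> (S - X) \<times> (S - X)) + ?lost) / (4 * D)"
    using p by (intro divide_right_mono mult_left_mono of_nat_mono) auto
  also have "\<dots> = p * card (R \<inter> (S - X) \<times> (S - X)) / (4 * D) + p / 2 * card X"
    using D by (simp add: field_simps)
  finally have "p * card (R \<inter> S \<times> S) / (4 * D)
      \<le> p * card (R \<inter> (S - X) \<times> (S - X)) / (4 * D) + p / 2 * card X" .
  moreover have "real (card (S - X)) / D \<le> card S / D"
    using S by (intro divide_right_mono) (auto intro: card_mono)
  ultimately show ?thesis unfolding independence_exponent_def by linarith
qed

lemma prob_independent_le_if_branches_le:
  assumes p: "0 \<le> p" "p \<le> 1" and S: "finite S" "v \<in> S" and R: "sym R" "irrefl R"
  defines "N \<equiv> R `` {v} \<inter> S"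
  defines "q \<equiv> \<lambda>T. measure_pmf.prob (random_subset_pmf T p) (independent_sets R)"
  assumes degree: "4 \<le> p * card N" and B: "0 \<le> B"
    and avoid: "q (S - {v}) \<le> B * exp (p / 2)"
    and contain: "q (S - insert v N) \<le> B * exp (p / 2 * (real (card N) + 1))"
  shows "q S \<le> B"
proof -
  have "q S = (1 - p) * q (S - {v}) + p * (1 - p) ^ card N * q (S - insert v N)"
    unfolding N_def q_def by (rule prob_independent_remove_vertex[OF p S R])
  also have "\<dots> \<le> (1 - p) * (B * exp (p / 2))
      + p * (1 - p) ^ card N * (B * exp (p / 2 * (real (card N) + 1)))"
    using p avoid contain by (intro add_mono mult_left_mono) auto
  also have "\<dots> = B * ((1 - p) * exp (p / 2) + p * (1 - p) ^ card N * exp (p / 2 * (real (card N) + 1)))"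
    by (simp add: algebra_simps)
  also have "\<dots> \<le> B * 1"
    by (intro mult_left_mono branching_factor_le_1 p degree B)
  finally show ?thesis by simp
qed

text \<open>The recursion removes a vertex \<open>v\<close> of degree at least \<open>4 / p\<close> if it is not chosen, and \<open>v\<close> with all
  its neighbours if it is chosen. Either way it loses at most \<open>2 * D\<close> pairs per removed vertex.\<close>

lemma prob_independent_le:
  assumes "finite S" and p: "0 < p" "p \<le> 1" and R: "sym R" "irrefl R"
    and D: "D > 0" and deg: "\<And>x. x \<in> S \<Longrightarrow> card (R `` {x} \<inter> S) \<le> D"
  shows "measure_pmf.prob (random_subset_pmf S p) (independent_sets R)
    \<le> exp (independence_exponent p D R S)"
  using assms(1) deg
proof (induction "card S" arbitrary: S rule: less_induct)
  case less
  note fin = \<open>finite S\<close>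
  let ?\<phi> = "independence_exponent p D R"
  define q where "q T = measure_pmf.prob (random_subset_pmf T p) (independent_sets R)" for T
  show ?case
  proof (cases "real (card (R \<inter> S \<times> S)) \<le> 4 / p * card S")
    case True
    then have "p * card (R \<inter> S \<times> S) / (4 * D) \<le> 4 * real (card S) / (4 * D)"
      using p by (intro divide_right_mono) (auto simp: field_simps)
    then have "1 \<le> exp (?\<phi> S)" by (simp add: independence_exponent_def)
    then show ?thesis by (rule order_trans[rotated]) simp
  next
    case False
    then obtain v where v: "v \<in> S" "4 / p \<le> card (R `` {v} \<inter> S)"
      using exists_large_degree[OF fin, of "4 / p" R] by auto
    define N where "N = R `` {v} \<inter> S"
    have N: "finite N" "v \<notin> N" "N \<subseteq> S" using fin R by (auto simp: N_def irrefl_def)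
    have pN: "4 \<le> p * card N" using v(2) p by (simp add: N_def field_simps)
    have remove: "q (S - X) \<le> exp (?\<phi> S) * exp (p / 2 * card X)" if X: "X \<subseteq> S" "v \<in> X" for X
    proof -
      have "card (S - X) < card S" using X v fin by (intro psubset_card_mono) auto
      moreover have "card (R `` {x} \<inter> (S - X)) \<le> D" if "x \<in> S - X" for x
        by (rule order_trans[OF card_mono less.prems(2)[of x]]) (use fin that in auto)
      ultimately have "q (S - X) \<le> exp (?\<phi> (S - X))"
        using less.hyps[of "S - X"] fin unfolding q_def by auto
      also have "\<dots> \<le> exp (?\<phi> S + p / 2 * card X)"
        using independence_exponent_Diff_le[of p D S X R] p D fin X R less.prems by auto
      finally show ?thesis by (simp add: exp_add)
    qed
    show ?thesis
      using prob_independent_le_if_branches_le[of p S v R "exp (?\<phi> S)"] p fin v R pN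
        remove[of "{v}"] remove[of "insert v N"] N
      by (simp add: N_def q_def add.commute)
  qed
qed

subsection \<open>Counting\<close>

lemma card_le_mult_card_image:
  assumes "finite A" "\<And>y. card {x \<in> A. f x = y} \<le> m"
  shows "card A \<le> m * card (f ` A)"
proof -
  have "card A = (\<Sum>y\<in>f ` A. card {x \<in> A. f x = y})"
    using sum.image_gen[OF assms(1), of "\<lambda>_. 1 :: nat" f] by simp
  also have "\<dots> \<le> m * card (f ` A)"
    using sum_bounded_above[of "f ` A" "\<lambda>y. card {x \<in> A. f x = y}" m] assms(2) by (simp add: mult.commute)
  finally show ?thesis .
qed

lemma mult_card_le_if_iterates_hit:
  fixes f :: "'a \<Rightarrow> 'a"
  assumes f: "inj f" and fin: "finite A" "finite B"
    and hit: "\<And>x. x \<in> A \<Longrightarrow> j \<le> (\<Sum>i<m. of_bool ((f ^^ i) x \<in> B))"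
  shows "j * card A \<le> m * card B"
proof -
  have "j * card A = (\<Sum>x\<in>A. j)" by simp
  also have "\<dots> \<le> (\<Sum>x\<in>A. \<Sum>i<m. of_bool ((f ^^ i) x \<in> B))"
    by (intro sum_mono hit)
  also have "\<dots> = (\<Sum>i<m. card {x \<in> A. (f ^^ i) x \<in> B})"
    using fin by (subst sum.swap) (simp add: sum.If_cases Int_def of_bool_def)
  also have "\<dots> \<le> (\<Sum>i<m. card B)"
    using fin f by (intro sum_mono card_inj_on_le[of "f ^^ _"])
      (auto intro: inj_on_subset[OF inj_fn[OF f] subset_UNIV])
  finally show ?thesis by simp
qed

lemma card_Image_map_prod_le:
  assumes fibre: "finite (f -` {y})" "card (f -` {y}) \<le> m"
    and Q: "finite Q" "\<And>x. card (Q `` {x}) \<le> D"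
  shows "card ((map_prod f g ` Q) `` {y}) \<le> m * D"
proof -
  have fin: "finite (Q `` {x})" for x using Q(1) by (simp add: finite_Image)
  have "(map_prod f g ` Q) `` {y} = g ` (\<Union>x\<in>f -` {y}. Q `` {x})" by force
  then have "card ((map_prod f g ` Q) `` {y}) \<le> card (\<Union>x\<in>f -` {y}. Q `` {x})"
    using fibre(1) fin by (simp add: card_image_le)
  also have "\<dots> \<le> (\<Sum>x\<in>f -` {y}. card (Q `` {x}))"
    using fibre(1) by (rule card_UN_le)
  also have "\<dots> \<le> card (f -` {y}) * D"
    using Q(2) sum_bounded_above[of "f -` {y}" "\<lambda>x. card (Q `` {x})" D] by simp
  also have "\<dots> \<le> m * D" using fibre(2) by simp
  finally show ?thesis .
qed

lemma card_Sigma_const: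
  assumes "finite A" "\<And>x. x \<in> A \<Longrightarrow> finite (B x) \<and> card (B x) = m"
  shows "card (Sigma A B) = card A * m"
  using assms by simp

definition distinct_triples :: "'a set \<Rightarrow> ('a \<times> 'a \<times> 'a) set" where
  "distinct_triples V = (SIGMA a:V. SIGMA b:V - {a}. V - {a, b})"

definition distinct_quadruples :: "'a set \<Rightarrow> ('a \<times> 'a \<times> 'a \<times> 'a) set" where
  "distinct_quadruples V = (SIGMA a:V. SIGMA b:V - {a}. SIGMA c:V - {a, b}. V - {a, b, c})"

lemma finite_distinct_triples: "finite V \<Longrightarrow> finite (distinct_triples V)"
  by (simp add: distinct_triples_def)

lemma finite_distinct_quadruples: "finite V \<Longrightarrow> finite (distinct_quadruples V)"
  by (simp add: distinct_quadruples_def)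

lemma in_distinct_triples_iff:
  "(a, b, c) \<in> distinct_triples V \<longleftrightarrow> {a, b, c} \<subseteq> V \<and> distinct [a, b, c]"
  by (auto simp: distinct_triples_def)

lemma in_distinct_quadruples_iff:
  "(a, b, c, d) \<in> distinct_quadruples V \<longleftrightarrow> {a, b, c, d} \<subseteq> V \<and> distinct [a, b, c, d]"
  by (auto simp: distinct_quadruples_def)

lemma card_distinct_triples:
  assumes "finite V"
  shows "card (distinct_triples V) = card V * ((card V - 1) * (card V - 2))"
  unfolding distinct_triples_def
proof (rule card_Sigma_const)
  fix a assume a: "a \<in> V"
  have "card (SIGMA b:V - {a}. V - {a, b}) = card (V - {a}) * (card V - 2)"
    using assms a by (intro card_Sigma_const) auto
  then show "finite (SIGMA b:V - {a}. V - {a, b}) \<and>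
      card (SIGMA b:V - {a}. V - {a, b}) = (card V - 1) * (card V - 2)"
    using assms a by simp
qed (use assms in auto)

lemma card_distinct_quadruples:
  assumes "finite V"
  shows "card (distinct_quadruples V) = card V * ((card V - 1) * ((card V - 2) * (card V - 3)))"
proof -
  have "distinct_quadruples V = (SIGMA a:V. distinct_triples (V - {a}))"
    by (auto simp: distinct_quadruples_def distinct_triples_def)
  also have "card \<dots> = card V * ((card V - 1) * ((card V - 2) * (card V - 3)))"
    using assms by (intro card_Sigma_const)
      (auto simp: finite_distinct_triples card_distinct_triples numeral_eq_Suc)
  finally show ?thesis .
qed

lemma exists_large_matching:
  assumes X: "finite X"
    and edge: "\<And>W. W \<subseteq> X \<Longrightarrow> N < card W \<Longrightarrow> \<exists>x\<in>W. \<exists>y\<in>W. (x, y) \<in> B"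
  shows "\<exists>M \<subseteq> B \<inter> X \<times> X. single_valued M \<and> single_valued (M\<inverse>) \<and> card X \<le> 2 * card M + N"
proof -
  define matching where "matching M \<longleftrightarrow> M \<subseteq> B \<inter> X \<times> X \<and> single_valued M \<and> single_valued (M\<inverse>)" for M
  have "card M \<le> card (X \<times> X)" if "matching M" for M
    using that X by (intro card_mono) (auto simp: matching_def)
  then have "\<forall>M. matching M \<longrightarrow> card M < Suc (card (X \<times> X))" by (simp add: le_imp_less_Suc)
  moreover have "matching {}" by (simp add: matching_def)
  ultimately obtain M where M: "matching M" and max: "\<And>M'. matching M' \<Longrightarrow> card M' \<le> card M"
    using ex_has_greatest_nat[of matching "{}" card] by blast
  have finM: "finite M" using M X by (auto simp: matching_def intro: finite_subset)
  define W where "W = X - (Domain M \<union> Range M)"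
  have "card W \<le> N"
  proof (rule ccontr)
    assume "\<not> card W \<le> N"
    moreover have "W \<subseteq> X" by (auto simp: W_def)
    ultimately obtain x y where xy: "x \<in> W" "y \<in> W" "(x, y) \<in> B" using edge[of W] by force
    then have "x \<notin> Domain M" "y \<notin> Range M" by (auto simp: W_def)
    then have "(x, y) \<notin> M" "single_valued (insert (x, y) M)" "single_valued ((insert (x, y) M)\<inverse>)"
      using M by (auto simp: matching_def single_valued_def)
    moreover from this have "matching (insert (x, y) M)"
      using M xy by (auto simp: matching_def W_def)
    ultimately show False using max[of "insert (x, y) M"] finM by simp
  qed
  moreover have "X \<subseteq> W \<union> (fst ` M \<union> snd ` M)"
    unfolding W_def Domain_fst Range_snd by blast
  then have "card X \<le> card (W \<union> (fst ` M \<union> snd ` M))"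
    using X finM by (intro card_mono) (auto simp: W_def)
  moreover have "card (fst ` M) \<le> card M" "card (snd ` M) \<le> card M"
    using finM by (simp_all add: card_image_le)
  ultimately have "card X \<le> 2 * card M + N"
    using card_Un_le[of W "fst ` M \<union> snd ` M"] card_Un_le[of "fst ` M" "snd ` M"] by linarith
  then show ?thesis using M unfolding matching_def by blast
qed

subsection \<open>Diagonal matrices\<close>

interpretation function_space: vector_space "\<lambda>(c :: 'b :: field) f (x :: 'a). c * f x"
  by unfold_locales (auto simp: fun_eq_iff algebra_simps)

lemma card_le_if_diagonal_in_span:
  fixes h :: "'a \<Rightarrow> 'a \<Rightarrow> 'b :: field"
  assumes T: "finite T" and span: "\<And>x. x \<in> W \<Longrightarrow> h x \<in> function_space.span T"
    and diag: "\<And>x. x \<in> W \<Longrightarrow> h x x \<noteq> 0"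
    and off_diag: "\<And>x y. x \<in> W \<Longrightarrow> y \<in> W \<Longrightarrow> x \<noteq> y \<Longrightarrow> h x y = 0"
  shows "card W \<le> card T"
proof -
  have inj: "inj_on h W"
  proof (rule inj_onI, rule ccontr)
    fix x y assume "x \<in> W" "y \<in> W" "h x = h y" "x \<noteq> y"
    then show False using diag[of y] off_diag[of x y] by simp
  qed
  have "h x \<notin> function_space.span (h ` W - {h x})" if x: "x \<in> W" for x
  proof
    assume "h x \<in> function_space.span (h ` W - {h x})"
    moreover have "function_space.span (h ` W - {h x}) \<subseteq> {f. f x = 0}"
    proof (rule function_space.span_minimal)
      show "h ` W - {h x} \<subseteq> {f. f x = 0}"
      proof
        fix f assume "f \<in> h ` W - {h x}"
        then obtain y where "y \<in> W" "y \<noteq> x" "f = h y" by blast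
        then show "f \<in> {f. f x = 0}" using off_diag[of y x] x by simp
      qed
    qed (simp add: function_space.subspace_def)
    ultimately show False using diag[OF x] by blast
  qed
  then have "\<not> function_space.dependent (h ` W)"
    unfolding function_space.dependent_def by blast
  then have "card (h ` W) \<le> card T"
    using function_space.independent_span_bound[OF T, of "h ` W"] span by blast
  then show ?thesis by (simp add: card_image[OF inj])
qed

subsection \<open>Vertex pairs\<close>

lemma finite_vertex_pairs: "finite V \<Longrightarrow> finite (vertex_pairs V)"
  by (simp add: vertex_pairs_def)

lemma card_vertex_pairs_le:
  assumes "finite V"
  shows "2 * card (vertex_pairs V) \<le> (card V)\<^sup>2"
proof -
  have "2 * card (vertex_pairs V) \<le> card V * (card V - 1)"
    using assms by (simp add: vertex_pairs_def n_subsets choose_two times_div_less_eq_dividend)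
  also have "\<dots> \<le> (card V)\<^sup>2" by (simp add: power2_eq_square)
  finally show ?thesis .
qed

lemma doubleton_in_vertex_pairs_iff [simp]:
  "{a, b} \<in> vertex_pairs V \<longleftrightarrow> a \<in> V \<and> b \<in> V \<and> a \<noteq> b"
  by (auto simp: vertex_pairs_def card_insert_if)

lemma disjoint_vertex_pairsE:
  assumes "e \<in> vertex_pairs V" "f \<in> vertex_pairs V" "e \<inter> f = {}"
  obtains a b c d where "e = {a, b}" "f = {c, d}" "distinct [a, b, c, d]" "{a, b, c, d} \<subseteq> V"
proof -
  obtain a b where e: "e = {a, b}" "a \<noteq> b"
    using assms(1) unfolding vertex_pairs_def card_2_iff by blast
  obtain c d where f: "f = {c, d}" "c \<noteq> d"
    using assms(2) unfolding vertex_pairs_def card_2_iff by blast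
  show thesis
    by (rule that[of a b c d]) (use assms e f in \<open>auto simp: vertex_pairs_def\<close>)
qed

definition endpoints :: "'a \<times> 'a \<Rightarrow> 'a set" where
  "endpoints = (\<lambda>(a, b). {a, b})"

lemma endpoints_simp [simp]: "endpoints (a, b) = {a, b}"
  by (simp add: endpoints_def)

lemma finite_vimage_endpoints: "finite (endpoints -` {e})"
  and card_vimage_endpoints_le: "card (endpoints -` {e}) \<le> 2"
proof -
  have "\<exists>d d'. endpoints -` {e} \<subseteq> {d, d'}"
  proof (cases "endpoints -` {e} = {}")
    case False
    then obtain q where q: "endpoints q = e" by blast
    have "d \<in> {q, prod.swap q}" if "endpoints d = e" for d
      using that unfolding q[symmetric] endpoints_def case_prod_unfold doubleton_eq_iff
      by (cases d; cases q) auto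
    then show ?thesis by blast
  qed simp
  then obtain d d' where sub: "endpoints -` {e} \<subseteq> {d, d'}" by blast
  then show "finite (endpoints -` {e})" by (rule finite_subset) simp
  have "card (endpoints -` {e}) \<le> card {d, d'}" using sub by (intro card_mono) auto
  also have "\<dots> \<le> 2" by (simp add: card_insert_if)
  finally show "card (endpoints -` {e}) \<le> 2" .
qed

lemma card_le_card_map_prod_endpoints:
  fixes Q :: "(('a \<times> 'a) \<times> ('a \<times> 'a)) set"
  assumes "finite Q"
  shows "card Q \<le> 4 * card (map_prod endpoints endpoints ` Q)"
proof (rule card_le_mult_card_image[OF assms])
  fix q :: "'a set \<times> 'a set"
  obtain e f where q: "q = (e, f)" by (rule prod.exhaust)
  have "{x \<in> Q. map_prod endpoints endpoints x = q} \<subseteq> (endpoints -` {e}) \<times> (endpoints -` {f})"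
    unfolding q map_prod_def case_prod_unfold by (simp add: subset_iff mem_Times_iff)
  then have "card {x \<in> Q. map_prod endpoints endpoints x = q}
      \<le> card ((endpoints -` {e}) \<times> (endpoints -` {f}))"
    by (intro card_mono finite_cartesian_product finite_vimage_endpoints)
  also have "\<dots> \<le> 2 * 2"
    unfolding card_cartesian_product by (rule mult_le_mono; rule card_vimage_endpoints_le)
  finally show "card {x \<in> Q. map_prod endpoints endpoints x = q} \<le> 4" by simp
qed

lemma card_quadruples_le:
  fixes Q :: "('a \<times> 'a \<times> 'a \<times> 'a) set"
  assumes Q: "finite Q" and C: "finite C" and sub: "\<And>a b c d. (a, b, c, d) \<in> Q \<Longrightarrow> ({a, b}, {c, d}) \<in> C"
  shows "card Q \<le> 4 * card C"
proof -
  define pairing :: "'a \<times> 'a \<times> 'a \<times> 'a \<Rightarrow> ('a \<times> 'a) \<times> ('a \<times> 'a)"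
    where "pairing = (\<lambda>(a, b, c, d). ((a, b), (c, d)))"
  have "card Q = card (pairing ` Q)"
    by (intro card_image[symmetric] inj_onI) (auto simp: pairing_def)
  also have "\<dots> \<le> 4 * card (map_prod endpoints endpoints ` pairing ` Q)"
    using Q by (intro card_le_card_map_prod_endpoints) simp
  also have "map_prod endpoints endpoints ` pairing ` Q \<subseteq> C"
    using sub by (auto simp: pairing_def)
  then have "card (map_prod endpoints endpoints ` pairing ` Q) \<le> card C"
    using C by (intro card_mono)
  finally show ?thesis by simp
qed

text \<open>A dart \<open>(u, x)\<close> is the vertex pair \<open>{u, x}\<close> with a distinguished endpoint \<open>u\<close>.\<close>

definition matching_darts :: "'a set \<Rightarrow> ('a \<Rightarrow> 'a \<Rightarrow> ('a \<times> 'a) set) \<Rightarrow> (('a \<times> 'a) \<times> ('a \<times> 'a)) set" where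
  "matching_darts V M = {((u, x), (v, y)) | u v x y. u \<in> V \<and> v \<in> V \<and> u \<noteq> v \<and> (x, y) \<in> M u v}"

lemma converse_matching_darts: "(matching_darts V M)\<inverse> = matching_darts V (\<lambda>v u. (M u v)\<inverse>)"
  by (auto simp: matching_darts_def)

lemma card_Image_matching_darts_le:
  assumes V: "finite V" and M: "\<And>u v. u \<in> V \<Longrightarrow> v \<in> V \<Longrightarrow> u \<noteq> v \<Longrightarrow> single_valued (M u v)"
  shows "card (matching_darts V M `` {d}) \<le> card V"
proof (rule card_inj_on_le[OF _ _ V])
  show "inj_on fst (matching_darts V M `` {d})"
    by (auto simp: inj_on_def matching_darts_def) (meson M single_valuedD)
qed (auto simp: matching_darts_def)

lemma
  assumes V: "finite V" and M: "\<And>u v. u \<in> V \<Longrightarrow> v \<in> V \<Longrightarrow> u \<noteq> v \<Longrightarrow> finite (M u v)"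
  shows finite_matching_darts: "finite (matching_darts V M)"
    and card_matching_darts: "card (matching_darts V M) = (\<Sum>u\<in>V. \<Sum>v\<in>V - {u}. card (M u v))"
proof -
  define T where "T = (SIGMA u:V. SIGMA v:V - {u}. M u v)"
  define dart :: "'a \<times> 'a \<times> 'a \<times> 'a \<Rightarrow> ('a \<times> 'a) \<times> ('a \<times> 'a)"
    where "dart = (\<lambda>(u, v, x, y). ((u, x), (v, y)))"
  have eq: "matching_darts V M = dart ` T"
    by (force simp: matching_darts_def T_def dart_def)
  show "finite (matching_darts V M)"
    unfolding eq T_def using V M by (intro finite_imageI finite_SigmaI) auto
  have "card (matching_darts V M) = card T"
    unfolding eq by (intro card_image inj_onI) (auto simp: dart_def)
  also have "\<dots> = (\<Sum>u\<in>V. card (SIGMA v:V - {u}. M u v))"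
    unfolding T_def using V M by (intro card_SigmaI) (auto intro!: finite_SigmaI)
  also have "\<dots> = (\<Sum>u\<in>V. \<Sum>v\<in>V - {u}. card (M u v))"
    using V M by (intro sum.cong refl card_SigmaI) auto
  finally show "card (matching_darts V M) = (\<Sum>u\<in>V. \<Sum>v\<in>V - {u}. card (M u v))" .
qed

lemma card_Image_endpoints_matching_darts_le:
  assumes V: "finite V" and fin: "\<And>u v. u \<in> V \<Longrightarrow> v \<in> V \<Longrightarrow> u \<noteq> v \<Longrightarrow> finite (M u v)"
    and M: "\<And>u v. u \<in> V \<Longrightarrow> v \<in> V \<Longrightarrow> u \<noteq> v \<Longrightarrow> single_valued (M u v)"
  shows "card ((map_prod endpoints endpoints ` matching_darts V M) `` {e}) \<le> 2 * card V"
  by (intro card_Image_map_prod_le finite_vimage_endpoints card_vimage_endpoints_le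
      finite_matching_darts card_Image_matching_darts_le assms)

lemma exists_sparse_subrelation_if_matchings:
  fixes M :: "'a \<Rightarrow> 'a \<Rightarrow> ('a \<times> 'a) set"
  assumes V: "finite V" and C: "sym C" "finite C"
    and M: "\<And>u v. u \<in> V \<Longrightarrow> v \<in> V \<Longrightarrow> u \<noteq> v \<Longrightarrow>
      finite (M u v) \<and> single_valued (M u v) \<and> single_valued ((M u v)\<inverse>)"
    and sub: "\<And>u v x y. u \<in> V \<Longrightarrow> v \<in> V \<Longrightarrow> u \<noteq> v \<Longrightarrow> (x, y) \<in> M u v \<Longrightarrow> ({u, x}, {v, y}) \<in> C"
  shows "\<exists>R \<subseteq> C. sym R \<and> (\<forall>e. card (R `` {e}) \<le> 4 * card V) \<and>
    (\<Sum>u\<in>V. \<Sum>v\<in>V - {u}. card (M u v)) \<le> 4 * card R"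
proof (intro exI conjI allI)
  define R\<^sub>0 where "R\<^sub>0 = map_prod endpoints endpoints ` matching_darts V M"
  have "R\<^sub>0 \<subseteq> C" using sub by (auto simp: R\<^sub>0_def matching_darts_def)
  then show R_sub: "R\<^sub>0 \<union> R\<^sub>0\<inverse> \<subseteq> C" using C(1) by (auto simp: sym_def)
  show "sym (R\<^sub>0 \<union> R\<^sub>0\<inverse>)" by (auto simp: sym_def)
  show "card ((R\<^sub>0 \<union> R\<^sub>0\<inverse>) `` {e}) \<le> 4 * card V" for e
  proof -
    have "R\<^sub>0\<inverse> = map_prod endpoints endpoints ` (matching_darts V M)\<inverse>"
      unfolding R\<^sub>0_def by force
    then have "card (R\<^sub>0\<inverse> `` {e}) \<le> 2 * card V"
      unfolding converse_matching_darts by (simp add: card_Image_endpoints_matching_darts_le V M)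
    moreover have "card (R\<^sub>0 `` {e}) \<le> 2 * card V"
      unfolding R\<^sub>0_def by (simp add: card_Image_endpoints_matching_darts_le V M)
    ultimately show ?thesis
      using card_Un_le[of "R\<^sub>0 `` {e}" "R\<^sub>0\<inverse> `` {e}"] by (simp add: Un_Image)
  qed
  have "(\<Sum>u\<in>V. \<Sum>v\<in>V - {u}. card (M u v)) = card (matching_darts V M)"
    using V M by (simp add: card_matching_darts)
  also have "\<dots> \<le> 4 * card R\<^sub>0"
    unfolding R\<^sub>0_def using V M by (intro card_le_card_map_prod_endpoints finite_matching_darts) auto
  also have "card R\<^sub>0 \<le> card (R\<^sub>0 \<union> R\<^sub>0\<inverse>)"
    using finite_subset[OF R_sub C(2)] by (intro card_mono) auto
  finally show "(\<Sum>u\<in>V. \<Sum>v\<in>V - {u}. card (M u v)) \<le> 4 * card (R\<^sub>0 \<union> R\<^sub>0\<inverse>)" by simp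
qed

subsection \<open>Ranks in linear orders\<close>

definition rank_in :: "('a \<times> 'a) set \<Rightarrow> 'a \<Rightarrow> nat" where
  "rank_in r x = card (underS r x)"

lemma rank_in_less_iff:
  assumes V: "finite V" and r: "linear_order_on V r" and xy: "x \<in> V" "y \<in> V"
  shows "rank_in r x < rank_in r y \<longleftrightarrow> (x, y) \<in> r \<and> x \<noteq> y"
proof -
  have less: "rank_in r a < rank_in r b" if "(a, b) \<in> r" "a \<noteq> b" for a b
    unfolding rank_in_def
  proof (rule psubset_card_mono)
    show "finite (underS r b)"
      using r by (intro finite_subset[OF _ V]) (auto simp: order_on_defs underS_def)
    have "underS r a \<subseteq> underS r b"
      using r that by (intro underS_incr) (auto simp: order_on_defs)
    moreover have "a \<in> underS r b" "a \<notin> underS r a" using that by (auto simp: underS_def)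
    ultimately show "underS r a \<subset> underS r b" by blast
  qed
  show ?thesis
  proof (cases "x = y")
    case False
    then have "(x, y) \<in> r \<or> (y, x) \<in> r" using r xy by (auto simp: order_on_defs total_on_def)
    then show ?thesis using False less[of x y] less[of y x] by force
  qed simp
qed

lemma inj_on_rank_in:
  assumes "finite V" and r: "linear_order_on V r"
  shows "inj_on (rank_in r) V"
proof (rule inj_onI, rule ccontr)
  fix x y assume "x \<in> V" "y \<in> V" "rank_in r x = rank_in r y" "x \<noteq> y"
  then show False
    using rank_in_less_iff[OF assms, of x y] rank_in_less_iff[OF assms, of y x] r
    by (auto simp: order_on_defs total_on_def)
qed

lemma rank_in_less_card:
  assumes V: "finite V" and r: "linear_order_on V r" and x: "x \<in> V"
  shows "rank_in r x < card V"
  unfolding rank_in_def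
  by (rule psubset_card_mono[OF V]) (use r x in \<open>auto simp: order_on_defs underS_def\<close>)

lemma linear_order_on_subset: "linear_order_on V r \<Longrightarrow> r \<subseteq> V \<times> V"
  by (simp add: order_on_defs)

lemma linear_order_on_eqI:
  assumes "linear_order_on V r" "linear_order_on V s"
    and "\<And>x y. x \<in> V \<Longrightarrow> y \<in> V \<Longrightarrow> (x, y) \<in> r \<longleftrightarrow> (x, y) \<in> s"
  shows "r = s"
  using assms(3) linear_order_on_subset[OF assms(1)] linear_order_on_subset[OF assms(2)] by auto

lemma linear_order_on_eq_if_rank_in_eq:
  assumes V: "finite V" and r: "linear_order_on V r" and s: "linear_order_on V s"
    and rank: "\<And>x. x \<in> V \<Longrightarrow> rank_in r x = rank_in s x"
  shows "r = s"
proof (rule linear_order_on_eqI[OF r s])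
  fix x y assume xy: "x \<in> V" "y \<in> V"
  show "(x, y) \<in> r \<longleftrightarrow> (x, y) \<in> s"
    using rank_in_less_iff[OF V r xy] rank_in_less_iff[OF V s xy] rank xy r s
    by (cases "x = y") (auto simp: order_on_defs refl_on_def)
qed

lemma finite_linear_orders:
  assumes "finite V"
  shows "finite {r. linear_order_on V r}"
  by (rule finite_subset[of _ "Pow (V \<times> V)"]) (use assms linear_order_on_subset in auto)

lemma card_linear_orders_le:
  assumes V: "finite V"
  shows "card {r. linear_order_on V r} \<le> card V ^ card V"
proof -
  have "card {r. linear_order_on V r} \<le> card (V \<rightarrow>\<^sub>E {..<card V})"
  proof (rule card_inj_on_le)
    show "inj_on (\<lambda>r. restrict (rank_in r) V) {r. linear_order_on V r}"
    proof (rule inj_onI)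
      fix r s assume "r \<in> {r. linear_order_on V r}" "s \<in> {r. linear_order_on V r}"
        and eq: "restrict (rank_in r) V = restrict (rank_in s) V"
      moreover have "rank_in r x = rank_in s x" if "x \<in> V" for x
        using fun_cong[OF eq, of x] that by simp
      ultimately show "r = s" by (intro linear_order_on_eq_if_rank_in_eq[OF V]) auto
    qed
  qed (use V rank_in_less_card in \<open>auto intro!: finite_PiE\<close>)
  then show ?thesis using V by (simp add: card_PiE)
qed

lemma all_precede_iff_rank_in:
  assumes "finite V" "linear_order_on V r" "A \<subseteq> V" "B \<subseteq> V"
  shows "all_precede r A B \<longleftrightarrow> (\<forall>x\<in>A. \<forall>y\<in>B. rank_in r x < rank_in r y)"
  using assms by (auto simp: all_precede_def rank_in_less_iff subset_iff)

subsection \<open>Separation by a linear order\<close>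

lemma separates_commute: "separates r e f \<longleftrightarrow> separates r f e"
  by (auto simp: separates_def)

lemma separates_three_matchings_if_least:
  assumes V: "finite V" and r: "linear_order_on V r"
    and abcd: "{a, b, c, d} \<subseteq> V" "distinct [a, b, c, d]"
    and least: "\<And>x. x \<in> {b, c, d} \<Longrightarrow> rank_in r a < rank_in r x"
  shows "of_bool (separates r {a, b} {c, d}) + of_bool (separates r {a, c} {d, b})
    + of_bool (separates r {a, d} {b, c}) = (1 :: nat)"
proof -
  have "separates r {a, x} {y, z} \<longleftrightarrow> rank_in r x < rank_in r y \<and> rank_in r x < rank_in r z"
    if "{x, y, z} \<subseteq> {b, c, d}" for x y z
  proof -
    have "{x, y, z} \<subseteq> V" using that abcd by auto
    then show ?thesis
      using least[of x] least[of y] least[of z] that abcd(1) unfolding separates_def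
      by (auto simp: all_precede_iff_rank_in[OF V r])
  qed
  moreover have "rank_in r b \<noteq> rank_in r c" "rank_in r c \<noteq> rank_in r d" "rank_in r b \<noteq> rank_in r d"
    using abcd by (simp_all add: inj_on_eq_iff[OF inj_on_rank_in[OF V r]])
  ultimately show ?thesis
    by (cases "rank_in r b < rank_in r c"; cases "rank_in r c < rank_in r d";
        cases "rank_in r b < rank_in r d") simp_all
qed

lemma separates_three_matchings:
  assumes V: "finite V" and r: "linear_order_on V r"
    and abcd: "{a, b, c, d} \<subseteq> V" "distinct [a, b, c, d]"
  shows "of_bool (separates r {a, b} {c, d}) + of_bool (separates r {a, c} {d, b})
    + of_bool (separates r {a, d} {b, c}) = (1 :: nat)"
proof -
  obtain x where x: "x \<in> {a, b, c, d}" "\<And>y. y \<in> {a, b, c, d} \<Longrightarrow> rank_in r x \<le> rank_in r y"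
    using arg_min_if_finite[of "{a, b, c, d}" "rank_in r"] by (meson finite.intros insert_not_empty not_less)
  have "rank_in r x < rank_in r y" if "y \<in> {a, b, c, d}" "y \<noteq> x" for y
  proof -
    have "x \<in> V" "y \<in> V" using x(1) that(1) abcd(1) by auto
    then show ?thesis
      using x(2)[OF that(1)] that(2) inj_on_eq_iff[OF inj_on_rank_in[OF V r], of x y] by simp
  qed
  then consider (a) "\<And>y. y \<in> {b, c, d} \<Longrightarrow> rank_in r a < rank_in r y"
    | (b) "\<And>y. y \<in> {a, d, c} \<Longrightarrow> rank_in r b < rank_in r y"
    | (c) "\<And>y. y \<in> {d, a, b} \<Longrightarrow> rank_in r c < rank_in r y"
    | (d) "\<And>y. y \<in> {c, b, a} \<Longrightarrow> rank_in r d < rank_in r y"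
    using x(1) abcd(2) by (elim insertE) auto
  then show ?thesis
  proof cases
    case a
    then show ?thesis by (intro separates_three_matchings_if_least[OF assms])
  next
    case b
    have "{b, a, d, c} \<subseteq> V" "distinct [b, a, d, c]" using abcd by auto
    from separates_three_matchings_if_least[OF V r this b] show ?thesis
      by (simp only: insert_commute separates_commute add_ac)
  next
    case c
    have "{c, d, a, b} \<subseteq> V" "distinct [c, d, a, b]" using abcd by auto
    from separates_three_matchings_if_least[OF V r this c] show ?thesis
      by (simp only: insert_commute separates_commute add_ac)
  next
    case d
    have "{d, c, b, a} \<subseteq> V" "distinct [d, c, b, a]" using abcd by auto
    from separates_three_matchings_if_least[OF V r this d] show ?thesis
      by (simp only: insert_commute separates_commute add_ac)
  qed
qed

lemma separates_three_extremes:
  assumes V: "finite V" and r: "linear_order_on V r"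
    and uvx: "{u, v, x} \<subseteq> V" "distinct [u, v, x]"
  shows "of_bool (separates r {u, v} {x}) + of_bool (separates r {v, x} {u})
    + of_bool (separates r {x, u} {v}) = (2 :: nat)"
proof -
  define m where "m = rank_in r"
  have "m u \<noteq> m v" "m u \<noteq> m x" "m v \<noteq> m x"
    using uvx by (simp_all add: m_def inj_on_eq_iff[OF inj_on_rank_in[OF V r]])
  moreover have "separates r {x, y} {z} \<longleftrightarrow> m x < m z \<and> m y < m z \<or> m z < m x \<and> m z < m y"
    if "{x, y, z} \<subseteq> V" for x y z
    using that all_precede_iff_rank_in[OF V r, of "{x, y}" "{z}"]
      all_precede_iff_rank_in[OF V r, of "{z}" "{x, y}"]
    by (auto simp: m_def separates_def)
  ultimately show ?thesis
    using uvx(1) by (cases "m u < m v"; cases "m u < m x"; cases "m v < m x") simp_all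
qed

lemma separates_pair_pair:
  assumes "antisym r"
  shows "of_bool (separates r {u, v} {x, y}) =
    of_bool (all_precede r {u, v} {x}) * of_bool (all_precede r {u, v} {y}) +
    of_bool (all_precede r {x} {u, v}) * (of_bool (all_precede r {y} {u, v}) :: 'b :: semiring_1)"
proof -
  have "all_precede r {u, v} {x, y} \<longleftrightarrow> all_precede r {u, v} {x} \<and> all_precede r {u, v} {y}"
    "all_precede r {x, y} {u, v} \<longleftrightarrow> all_precede r {x} {u, v} \<and> all_precede r {y} {u, v}"
    by (auto simp: all_precede_def)
  moreover have "\<not> (all_precede r {u, v} {x} \<and> all_precede r {x} {u, v})"
    using assms by (auto simp: all_precede_def antisym_def)
  ultimately show ?thesis by (auto simp: separates_def)
qed

subsection \<open>Conflicts of a family of orders\<close>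

definition separation_count :: "('a \<times> 'a) set multiset \<Rightarrow> 'a set \<Rightarrow> 'a set \<Rightarrow> nat" where
  "separation_count F e f = size (filter_mset (\<lambda>r. separates r e f) F)"

definition conflicts :: "'a set \<Rightarrow> ('a \<times> 'a) set multiset \<Rightarrow> nat \<Rightarrow> ('a set \<times> 'a set) set" where
  "conflicts V F l =
    {(e, f) \<in> vertex_pairs V \<times> vertex_pairs V. e \<inter> f = {} \<and> separation_count F e f \<noteq> l}"

lemma separation_count_eq_sum_mset:
  "separation_count F e f = (\<Sum>r\<in>#F. of_bool (separates r e f))"
  by (induction F) (simp_all add: separation_count_def)

lemma separation_count_commute: "separation_count F e f = separation_count F f e"
  by (simp add: separation_count_def separates_commute)

lemma separation_count_le_size: "separation_count F e f \<le> size F"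
  by (simp add: separation_count_def)

lemma sym_conflicts: "sym (conflicts V F l)"
  by (auto simp: sym_def conflicts_def separation_count_commute)

lemma irrefl_conflicts: "irrefl (conflicts V F l)"
  by (auto simp: irrefl_def conflicts_def vertex_pairs_def)

lemma conflicts_subset: "conflicts V F l \<subseteq> vertex_pairs V \<times> vertex_pairs V"
  by (auto simp: conflicts_def)

lemma finite_conflicts: "finite V \<Longrightarrow> finite (conflicts V F l)"
  by (rule finite_subset[OF conflicts_subset]) (simp add: finite_vertex_pairs)

lemma conflicts_doubletons_iff:
  "({a, b}, {c, d}) \<in> conflicts V F l \<longleftrightarrow>
    {a, b, c, d} \<subseteq> V \<and> distinct [a, b, c, d] \<and> separation_count F {a, b} {c, d} \<noteq> l"
  by (auto simp: conflicts_def)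

definition side_indicators :: "('a \<times> 'a) set multiset \<Rightarrow> 'a \<Rightarrow> 'a \<Rightarrow> ('a \<Rightarrow> real) set" where
  "side_indicators F u v = (\<Union>r\<in>set_mset F.
    {\<lambda>y. of_bool (all_precede r {u, v} {y}), \<lambda>y. of_bool (all_precede r {y} {u, v})})"

lemma side_indicators_add_mset:
  "side_indicators (add_mset r F) u v = insert (\<lambda>y. of_bool (all_precede r {u, v} {y}))
    (insert (\<lambda>y. of_bool (all_precede r {y} {u, v})) (side_indicators F u v))"
  by (auto simp: side_indicators_def)

lemma finite_side_indicators: "finite (side_indicators F u v)"
  by (simp add: side_indicators_def)

lemma card_side_indicators_le: "card (side_indicators F u v) \<le> 2 * size F"
proof (induction F)
  case (add r F)
  then show ?case by (simp add: side_indicators_add_mset card_insert_if finite_side_indicators)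
qed (simp add: side_indicators_def)

lemma separation_count_in_span:
  assumes "\<And>r. r \<in># F \<Longrightarrow> antisym r"
  shows "(\<lambda>y. real (separation_count F {u, v} {x, y}))
    \<in> function_space.span (side_indicators F u v)"
  using assms
proof (induction F)
  case empty
  have "(\<lambda>y. real (separation_count {#} {u, v} {x, y})) = 0"
    by (auto simp: separation_count_def)
  then show ?case by (simp only: function_space.span_zero)
next
  case (add r F)
  let ?above = "\<lambda>y. of_bool (all_precede r {u, v} {y}) :: real"
    and ?below = "\<lambda>y. of_bool (all_precede r {y} {u, v}) :: real"
  have "(\<lambda>y. real (separation_count F {u, v} {x, y})) \<in> function_space.span (side_indicators F u v)"
    using add by simp
  also have "\<dots> \<subseteq> function_space.span (side_indicators (add_mset r F) u v)"
    by (rule function_space.span_mono) (auto simp: side_indicators_add_mset)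
  finally have rest: "(\<lambda>y. real (separation_count F {u, v} {x, y}))
      \<in> function_space.span (side_indicators (add_mset r F) u v)" .
  have above: "?above \<in> function_space.span (side_indicators (add_mset r F) u v)"
    and below: "?below \<in> function_space.span (side_indicators (add_mset r F) u v)"
    by (rule function_space.span_base, simp add: side_indicators_add_mset)+
  have "real (separation_count (add_mset r F) {u, v} {x, y}) =
      real (separation_count F {u, v} {x, y}) + (?above x * ?above y + ?below x * ?below y)" for y
    using separates_pair_pair[of r u v x y, where ?'b = real] add.prems
    by (simp add: separation_count_eq_sum_mset)
  then have "(\<lambda>y. real (separation_count (add_mset r F) {u, v} {x, y})) =
      (\<lambda>y. real (separation_count F {u, v} {x, y})) + ((\<lambda>y. ?above x * ?above y) + (\<lambda>y. ?below x * ?below y))"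
    unfolding plus_fun_def by (rule ext)
  then show ?case
    using rest above below by (simp only: function_space.span_add function_space.span_scale)
qed

text \<open>An order separates \<open>{u, v}\<close> from \<open>{x}\<close> iff \<open>x\<close> does not lie between \<open>u\<close> and \<open>v\<close>.\<close>

definition unbalanced :: "'a set \<Rightarrow> ('a \<times> 'a) set multiset \<Rightarrow> nat \<Rightarrow> 'a \<Rightarrow> 'a \<Rightarrow> 'a set" where
  "unbalanced V F l u v = {x \<in> V - {u, v}. separation_count F {u, v} {x} + 2 * l \<noteq> size F}"

locale order_family =
  fixes V :: "'a set" and F :: "('a \<times> 'a) set multiset"
  assumes finite_V: "finite V" and linear_order: "r \<in># F \<Longrightarrow> linear_order_on V r"
begin

lemma separation_count_three_matchings:
  assumes "{a, b, c, d} \<subseteq> V" "distinct [a, b, c, d]"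
  shows "separation_count F {a, b} {c, d} + separation_count F {a, c} {d, b}
    + separation_count F {a, d} {b, c} = size F"
proof -
  have "separation_count F {a, b} {c, d} + separation_count F {a, c} {d, b} + separation_count F {a, d} {b, c}
      = (\<Sum>r\<in>#F. of_bool (separates r {a, b} {c, d}) + of_bool (separates r {a, c} {d, b})
          + of_bool (separates r {a, d} {b, c}))"
    by (simp add: separation_count_eq_sum_mset sum_mset.distrib)
  also have "\<dots> = (\<Sum>r\<in>#F. 1)"
    using assms by (intro arg_cong[of _ _ sum_mset] image_mset_cong
      separates_three_matchings[OF finite_V linear_order])
  finally show ?thesis by simp
qed

lemma separation_count_three_extremes:
  assumes "{u, v, x} \<subseteq> V" "distinct [u, v, x]"
  shows "separation_count F {u, v} {x} + separation_count F {v, x} {u}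
    + separation_count F {x, u} {v} = 2 * size F"
proof -
  have "separation_count F {u, v} {x} + separation_count F {v, x} {u} + separation_count F {x, u} {v}
      = (\<Sum>r\<in>#F. of_bool (separates r {u, v} {x}) + of_bool (separates r {v, x} {u})
          + of_bool (separates r {x, u} {v}))"
    by (simp add: separation_count_eq_sum_mset sum_mset.distrib)
  also have "\<dots> = (\<Sum>r\<in>#F. 2)"
    using assms by (intro arg_cong[of _ _ sum_mset] image_mset_cong
      separates_three_extremes[OF finite_V linear_order])
  finally show ?thesis by simp
qed

lemma card_conflicts_ge:
  assumes "3 * l \<noteq> size F"
  shows "card V * ((card V - 1) * ((card V - 2) * (card V - 3))) \<le> 12 * card (conflicts V F l)"
proof -
  define C where "C = {(a, b, c, d). ({a, b}, {c, d}) \<in> conflicts V F l}"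
  define rot :: "'a \<times> 'a \<times> 'a \<times> 'a \<Rightarrow> 'a \<times> 'a \<times> 'a \<times> 'a" where "rot = (\<lambda>(a, b, c, d). (a, c, d, b))"
  have "C \<subseteq> distinct_quadruples V"
    by (auto simp: C_def in_distinct_quadruples_iff conflicts_doubletons_iff)
  then have finC: "finite C" using finite_distinct_quadruples[OF finite_V] by (rule finite_subset)
  have "1 * card (distinct_quadruples V) \<le> 3 * card C"
  proof (rule mult_card_le_if_iterates_hit[OF _ finite_distinct_quadruples[OF finite_V] finC])
    show "inj rot" by (auto simp: rot_def inj_def)
  next
    fix q assume "q \<in> distinct_quadruples V"
    then obtain a b c d where q: "q = (a, b, c, d)" "{a, b, c, d} \<subseteq> V" "distinct [a, b, c, d]"
      by (cases q) (auto simp: in_distinct_quadruples_iff)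
    have "separation_count F {a, b} {c, d} \<noteq> l \<or> separation_count F {a, c} {d, b} \<noteq> l
        \<or> separation_count F {a, d} {b, c} \<noteq> l"
      using separation_count_three_matchings[OF q(2,3)] assms by linarith
    then have "q \<in> C \<or> rot q \<in> C \<or> rot (rot q) \<in> C"
      using q by (auto simp: C_def rot_def conflicts_doubletons_iff)
    then show "(1 :: nat) \<le> (\<Sum>i<3. of_bool ((rot ^^ i) q \<in> C))"
      by (auto simp: numeral_3_eq_3)
  qed
  moreover have "card C \<le> 4 * card (conflicts V F l)"
    using finC finite_conflicts[OF finite_V] by (rule card_quadruples_le) (simp add: C_def)
  ultimately show ?thesis
    using card_distinct_quadruples[OF finite_V] by simp
qed

text \<open>The matrix with entries \<open>separation_count F {u, v} {x, y}\<close> has rank at most \<open>2 * size F\<close>. If no pair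
  from \<open>W\<close> is in conflict, then its entries off the diagonal are all \<open>size F - 2 * l\<close>.\<close>

lemma card_crossing_conflict_free_le:
  assumes uv: "{u, v} \<subseteq> V" "u \<noteq> v" and W: "W \<subseteq> unbalanced V F l u v"
    and free: "\<And>x y. x \<in> W \<Longrightarrow> y \<in> W \<Longrightarrow> x \<noteq> y \<Longrightarrow> separation_count F {u, x} {v, y} = l"
  shows "card W \<le> 2 * size F + 1"
proof -
  let ?B = "insert (\<lambda>_. 1) (side_indicators F u v)"
  define h where "h = (\<lambda>x y. real (separation_count F {u, v} {x, y}) + (2 * real l - real (size F)))"
  have "card W \<le> card ?B"
  proof (rule card_le_if_diagonal_in_span[where h = h])
    show "finite ?B" by (simp add: finite_side_indicators)
    fix x assume x: "x \<in> W"
    show "h x x \<noteq> 0" using W x by (auto simp: h_def unbalanced_def simp flip: of_nat_add)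
    have "antisym r" if "r \<in># F" for r using linear_order[OF that] by (simp add: order_on_defs)
    then have "(\<lambda>y. real (separation_count F {u, v} {x, y})) \<in> function_space.span (side_indicators F u v)"
      by (rule separation_count_in_span)
    then have "(\<lambda>y. real (separation_count F {u, v} {x, y})) \<in> function_space.span ?B"
      using function_space.span_mono[of "side_indicators F u v" ?B] by blast
    moreover have "(\<lambda>_. (2 * real l - real (size F)) * 1) \<in> function_space.span ?B"
      by (rule function_space.span_scale[OF function_space.span_base]) simp
    ultimately have "(\<lambda>y. real (separation_count F {u, v} {x, y})) + (\<lambda>_. (2 * real l - real (size F)) * 1)
        \<in> function_space.span ?B"
      by (rule function_space.span_add)
    then show "h x \<in> function_space.span ?B" by (simp add: h_def plus_fun_def)
  next
    fix x y assume xy: "x \<in> W" "y \<in> W" "x \<noteq> y"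
    then have "{u, v, x, y} \<subseteq> V" "distinct [u, v, x, y]" using uv W by (auto simp: unbalanced_def)
    from separation_count_three_matchings[OF this]
    have "separation_count F {u, v} {x, y} + separation_count F {u, x} {v, y}
        + separation_count F {u, y} {v, x} = size F"
      by (simp add: insert_commute)
    then have "separation_count F {u, v} {x, y} + 2 * l = size F"
      using free[of x y] free[of y x] xy by simp
    then show "h x y = 0" by (simp add: h_def flip: of_nat_add)
  qed
  also have "\<dots> \<le> Suc (card (side_indicators F u v))"
    by (simp add: card_insert_if finite_side_indicators)
  also have "\<dots> \<le> Suc (2 * size F)" using card_side_indicators_le by simp
  finally show ?thesis by simp
qed

lemma exists_large_conflict_matching:
  assumes uv: "{u, v} \<subseteq> V" "u \<noteq> v"
  shows "\<exists>M. (\<forall>(x, y)\<in>M. ({u, x}, {v, y}) \<in> conflicts V F l) \<and> single_valued M \<and> single_valued (M\<inverse>) \<and>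
    card (unbalanced V F l u v) \<le> 2 * card M + (2 * size F + 1)"
proof -
  let ?X = "unbalanced V F l u v" and ?B = "{(x, y). ({u, x}, {v, y}) \<in> conflicts V F l}"
  have "finite ?X" using finite_V by (simp add: unbalanced_def)
  moreover have "\<exists>x\<in>W. \<exists>y\<in>W. (x, y) \<in> ?B" if W: "W \<subseteq> ?X" "2 * size F + 1 < card W" for W
  proof (rule ccontr)
    assume "\<not> (\<exists>x\<in>W. \<exists>y\<in>W. (x, y) \<in> ?B)"
    then have "separation_count F {u, x} {v, y} = l" if "x \<in> W" "y \<in> W" "x \<noteq> y" for x y
      using that uv W(1) by (auto simp: conflicts_doubletons_iff unbalanced_def)
    then have "card W \<le> 2 * size F + 1" by (rule card_crossing_conflict_free_le[OF uv W(1)])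
    then show False using W(2) by simp
  qed
  ultimately show ?thesis using exists_large_matching[of ?X "2 * size F + 1" ?B] by blast
qed

lemma sum_card_unbalanced_ge:
  assumes "3 * l = size F" "l > 0"
  shows "2 * (card V * ((card V - 1) * (card V - 2)))
    \<le> 3 * (\<Sum>u\<in>V. \<Sum>v\<in>V - {u}. card (unbalanced V F l u v))"
proof -
  define U where "U = (SIGMA u:V. SIGMA v:V - {u}. unbalanced V F l u v)"
  define rot :: "'a \<times> 'a \<times> 'a \<Rightarrow> 'a \<times> 'a \<times> 'a" where "rot = (\<lambda>(u, v, x). (v, x, u))"
  have "2 * card (distinct_triples V) \<le> 3 * card U"
  proof (rule mult_card_le_if_iterates_hit)
    show "inj rot" by (auto simp: rot_def inj_def)
    show "finite (distinct_triples V)" "finite U"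
      using finite_V by (simp_all add: finite_distinct_triples U_def unbalanced_def)
    fix t assume "t \<in> distinct_triples V"
    then obtain u v x where t: "t = (u, v, x)" "{u, v, x} \<subseteq> V" "distinct [u, v, x]"
      by (cases t) (auto simp: in_distinct_triples_iff)
    then have "t \<in> U \<longleftrightarrow> separation_count F {u, v} {x} \<noteq> l"
      "rot t \<in> U \<longleftrightarrow> separation_count F {v, x} {u} \<noteq> l"
      "rot (rot t) \<in> U \<longleftrightarrow> separation_count F {x, u} {v} \<noteq> l"
      using assms(1) by (auto simp: U_def rot_def unbalanced_def)
    then show "2 \<le> (\<Sum>i<3. of_bool ((rot ^^ i) t \<in> U) :: nat)"
      using separation_count_three_extremes[OF t(2,3)] assms separation_count_le_size[of F "{u, v}" "{x}"]
        separation_count_le_size[of F "{v, x}" "{u}"] separation_count_le_size[of F "{x, u}" "{v}"]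
      by (cases "t \<in> U"; cases "rot t \<in> U"; cases "rot (rot t) \<in> U") (simp_all add: numeral_3_eq_3)
  qed
  then show ?thesis
    using card_distinct_triples[OF finite_V] finite_V by (simp add: U_def unbalanced_def)
qed

lemma exists_conflict_matchings:
  "\<exists>M. \<forall>u\<in>V. \<forall>v\<in>V - {u}.
    (\<forall>x y. (x, y) \<in> M u v \<longrightarrow> ({u, x}, {v, y}) \<in> conflicts V F l) \<and>
    finite (M u v) \<and> single_valued (M u v) \<and> single_valued ((M u v)\<inverse>) \<and>
    card (unbalanced V F l u v) \<le> 2 * card (M u v) + (2 * size F + 1)"
proof (intro exI ballI)
  define is_matching where "is_matching u v M \<longleftrightarrow> (\<forall>(x, y)\<in>M. ({u, x}, {v, y}) \<in> conflicts V F l) \<and>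
    single_valued M \<and> single_valued (M\<inverse>) \<and> card (unbalanced V F l u v) \<le> 2 * card M + (2 * size F + 1)"
    for u v M
  define M where "M u v = (SOME M. is_matching u v M)" for u v
  fix u v assume uv: "u \<in> V" "v \<in> V - {u}"
  have M: "is_matching u v (M u v)"
    using someI_ex[OF exists_large_conflict_matching[of u v l, folded is_matching_def]] uv
    by (auto simp: M_def)
  then have conflict: "({u, x}, {v, y}) \<in> conflicts V F l" if "(x, y) \<in> M u v" for x y
    using that unfolding is_matching_def by blast
  then have "M u v \<subseteq> V \<times> V" by (auto simp: conflicts_doubletons_iff)
  then have "finite (M u v)" by (rule finite_subset) (simp add: finite_V)
  then show "(\<forall>x y. (x, y) \<in> M u v \<longrightarrow> ({u, x}, {v, y}) \<in> conflicts V F l) \<and>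
      finite (M u v) \<and> single_valued (M u v) \<and> single_valued ((M u v)\<inverse>) \<and>
      card (unbalanced V F l u v) \<le> 2 * card (M u v) + (2 * size F + 1)"
    using M conflict unfolding is_matching_def by blast
qed

lemma exists_sparse_conflicts:
  assumes l: "3 * l = size F" "l > 0"
  defines "n \<equiv> card V"
  shows "\<exists>R \<subseteq> conflicts V F l. sym R \<and> (\<forall>e. card (R `` {e}) \<le> 4 * n) \<and>
    2 * (n * ((n - 1) * (n - 2))) \<le> 24 * card R + 3 * (n * (n - 1) * (2 * size F + 1))"
proof -
  obtain M where M: "\<forall>u\<in>V. \<forall>v\<in>V - {u}.
      (\<forall>x y. (x, y) \<in> M u v \<longrightarrow> ({u, x}, {v, y}) \<in> conflicts V F l) \<and>
      finite (M u v) \<and> single_valued (M u v) \<and> single_valued ((M u v)\<inverse>) \<and>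
      card (unbalanced V F l u v) \<le> 2 * card (M u v) + (2 * size F + 1)"
    using exists_conflict_matchings by blast
  have "\<exists>R \<subseteq> conflicts V F l. sym R \<and> (\<forall>e. card (R `` {e}) \<le> 4 * card V) \<and>
      (\<Sum>u\<in>V. \<Sum>v\<in>V - {u}. card (M u v)) \<le> 4 * card R"
    using M by (intro exists_sparse_subrelation_if_matchings finite_V sym_conflicts finite_conflicts) auto
  then obtain R where R: "R \<subseteq> conflicts V F l" "sym R" "\<forall>e. card (R `` {e}) \<le> 4 * n"
    and card_M: "(\<Sum>u\<in>V. \<Sum>v\<in>V - {u}. card (M u v)) \<le> 4 * card R"
    unfolding n_def by blast
  have const: "(\<Sum>u\<in>V. \<Sum>v\<in>V - {u}. c) = n * (n - 1) * c" for c
    using finite_V by (simp add: n_def)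
  have "2 * (n * ((n - 1) * (n - 2))) \<le> 3 * (\<Sum>u\<in>V. \<Sum>v\<in>V - {u}. card (unbalanced V F l u v))"
    unfolding n_def by (rule sum_card_unbalanced_ge[OF l])
  also have "(\<Sum>u\<in>V. \<Sum>v\<in>V - {u}. card (unbalanced V F l u v)) \<le>
      (\<Sum>u\<in>V. \<Sum>v\<in>V - {u}. 2 * card (M u v) + (2 * size F + 1))"
    using M by (intro sum_mono) auto
  also have "\<dots> = 2 * (\<Sum>u\<in>V. \<Sum>v\<in>V - {u}. card (M u v)) + n * (n - 1) * (2 * size F + 1)"
    by (simp only: sum.distrib sum_distrib_left const distrib_left)
  finally have "2 * (n * ((n - 1) * (n - 2))) \<le> 24 * card R + 3 * (n * (n - 1) * (2 * size F + 1))"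
    using card_M by simp
  then show ?thesis using R by blast
qed

lemma card_conflicts_ge_quartic:
  assumes n: "100 \<le> card V" and l: "3 * l \<noteq> size F"
  shows "0.074 * real (card V) ^ 4 \<le> card (conflicts V F l)"
proof -
  let ?n = "real (card V)"
  have "0.888 * ?n ^ 4 \<le> ?n * (0.99 * ?n * (0.98 * ?n * (0.97 * ?n)))"
    by (simp add: power4_eq_xxxx)
  also have "\<dots> \<le> ?n * (real (card V - 1) * (real (card V - 2) * real (card V - 3)))"
    using n by (intro mult_mono) (auto simp: of_nat_diff)
  also have "\<dots> \<le> real (12 * card (conflicts V F l))"
    using card_conflicts_ge[OF l] by (simp flip: of_nat_mult)
  finally show ?thesis by simp
qed

lemma exists_sparse_conflicts_ge_cubic:
  assumes n: "100 \<le> card V" "200 * size F \<le> card V" and l: "3 * l = size F" "l > 0"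
  shows "\<exists>R \<subseteq> conflicts V F l. sym R \<and> (\<forall>e. card (R `` {e}) \<le> 4 * card V) \<and>
    0.074 * real (card V) ^ 3 \<le> card R"
proof -
  let ?n = "real (card V)"
  obtain R where R: "R \<subseteq> conflicts V F l" "sym R" "\<forall>e. card (R `` {e}) \<le> 4 * card V"
    and card_R: "2 * (card V * ((card V - 1) * (card V - 2))) \<le>
      24 * card R + 3 * (card V * (card V - 1) * (2 * size F + 1))"
    using exists_sparse_conflicts[OF l] by blast
  have "1.94 * ?n ^ 3 \<le> 2 * (?n * (0.99 * ?n * (0.98 * ?n)))"
    by (simp add: power3_eq_cube)
  also have "\<dots> \<le> 2 * (?n * (real (card V - 1) * real (card V - 2)))"
    using n(1) by (intro mult_left_mono mult_mono) (auto simp: of_nat_diff)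
  also have "\<dots> \<le> real (24 * card R + 3 * (card V * (card V - 1) * (2 * size F + 1)))"
    using card_R by (simp flip: of_nat_mult of_nat_add)
  also have "\<dots> = 24 * real (card R) + 3 * (?n * real (card V - 1) * (2 * real (size F) + 1))"
    by (simp only: of_nat_add of_nat_mult of_nat_numeral of_nat_1)
  also have "\<dots> \<le> 24 * real (card R) + 3 * (?n * ?n * (0.02 * ?n))"
    using n by (intro add_left_mono mult_left_mono mult_mono) auto
  finally have "0.074 * ?n ^ 3 \<le> card R"
    by (simp add: power3_eq_cube)
  then show ?thesis using R by blast
qed

lemma exists_dense_conflicts:
  assumes n: "100 \<le> card V" "200 * size F \<le> card V" and l: "l > 0"
  shows "\<exists>R D. R \<subseteq> conflicts V F l \<and> sym R \<and> (\<forall>e. card (R `` {e}) \<le> D) \<and> 4 * card V \<le> D \<and>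
    0.0185 * (real (card V))\<^sup>2 * real D \<le> real (card R)"
proof (cases "3 * l = size F")
  case False
  have "card (conflicts V F l `` {e}) \<le> (card V)\<^sup>2" for e
  proof -
    have "card (conflicts V F l `` {e}) \<le> card (vertex_pairs V)"
      using conflicts_subset by (intro card_mono finite_vertex_pairs finite_V) auto
    then show ?thesis using card_vertex_pairs_le[OF finite_V] by simp
  qed
  moreover have "4 * card V \<le> (card V)\<^sup>2" using n(1) by (simp add: power2_eq_square)
  moreover have "0.0185 * (real (card V))\<^sup>2 * real ((card V)\<^sup>2) \<le> 0.074 * real (card V) ^ 4"
    by (simp add: power4_eq_xxxx power2_eq_square)
  then have "0.0185 * (real (card V))\<^sup>2 * real ((card V)\<^sup>2) \<le> card (conflicts V F l)"
    using card_conflicts_ge_quartic[OF n(1) False] by linarith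
  ultimately show ?thesis using sym_conflicts by blast
next
  case True
  then obtain R where R: "R \<subseteq> conflicts V F l" "sym R" "\<forall>e. card (R `` {e}) \<le> 4 * card V"
    and card_R: "0.074 * real (card V) ^ 3 \<le> card R"
    using exists_sparse_conflicts_ge_cubic[OF n True l] by blast
  moreover have "0.0185 * (real (card V))\<^sup>2 * real (4 * card V) \<le> card R"
    using card_R by (simp add: power3_eq_cube power2_eq_square)
  ultimately show ?thesis by blast
qed

lemma prob_independent_conflicts_le:
  fixes p :: real
  defines "n \<equiv> card V"
  assumes p: "0 < p" "p \<le> 1" and n: "100 \<le> n" "200 * size F \<le> n" and l: "l > 0"
  shows "measure_pmf.prob (random_subset_pmf (vertex_pairs V) p) (independent_sets (conflicts V F l))
    \<le> exp (real n / 8 - 0.0046 * ((real n)\<^sup>2 * p))"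
proof -
  let ?S = "vertex_pairs V" and ?M = "random_subset_pmf (vertex_pairs V) p"
  obtain R D where R: "R \<subseteq> conflicts V F l" "sym R" and deg: "\<And>e. card (R `` {e}) \<le> D"
    and D: "4 * n \<le> D" and card_R: "0.0185 * (real n)\<^sup>2 * real D \<le> real (card R)"
    using exists_dense_conflicts[of l] n l unfolding n_def by blast
  have RS: "R \<inter> ?S \<times> ?S = R" "R `` {e} \<inter> ?S = R `` {e}" for e
    using R(1) conflicts_subset[of V F l] by auto
  have D_pos: "0 < D" using D n(1) by simp
  have "measure_pmf.prob ?M (independent_sets (conflicts V F l)) \<le> measure_pmf.prob ?M (independent_sets R)"
    using R(1) by (intro measure_pmf.finite_measure_mono independent_sets_antimono) auto
  also have "\<dots> \<le> exp (independence_exponent p D R ?S)"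
    using R p D_pos deg irrefl_conflicts[of V F l] finite_V
    by (intro prob_independent_le finite_vertex_pairs) (auto simp: RS irrefl_def)
  also have "independence_exponent p D R ?S \<le> real n / 8 - 0.0046 * ((real n)\<^sup>2 * p)"
  proof -
    have "2 * real (card ?S) \<le> (real n)\<^sup>2"
      using card_vertex_pairs_le[OF finite_V] unfolding n_def
      by (metis of_nat_le_iff of_nat_mult of_nat_numeral of_nat_power)
    then have "real (card ?S) \<le> real n / 8 * (4 * real n)" by (simp add: power2_eq_square)
    also have "\<dots> \<le> real n / 8 * real D" using D by (intro mult_left_mono) auto
    finally have "real (card ?S) / D \<le> real n / 8" using D_pos by (simp add: field_simps)
    moreover have "0.0046 * ((real n)\<^sup>2 * p) \<le> p * (0.0185 * (real n)\<^sup>2 * D) / (4 * D)"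
      using D_pos p by (simp add: field_simps)
    moreover have "\<dots> \<le> p * real (card R) / (4 * D)"
      using p card_R by (intro divide_right_mono mult_left_mono) auto
    ultimately show ?thesis unfolding independence_exponent_def RS by linarith
  qed
  finally show ?thesis by simp
qed

end

subsection \<open>Existence of perfect separating families\<close>

lemma exists_bij_betw_disjoint_images:
  assumes V: "finite V" and sub: "e \<subseteq> V" "f \<subseteq> V" "e' \<subseteq> V" "f' \<subseteq> V"
    and card: "card e = card e'" "card f = card f'" and disj: "e \<inter> f = {}" "e' \<inter> f' = {}"
  obtains g where "bij_betw g V V" "g ` e = e'" "g ` f = f'"
proof -
  have fin: "finite e" "finite f" "finite e'" "finite f'" using sub V finite_subset by blast+
  obtain g\<^sub>e where g\<^sub>e: "bij_betw g\<^sub>e e e'" using finite_same_card_bij fin card by blast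
  obtain g\<^sub>f where g\<^sub>f: "bij_betw g\<^sub>f f f'" using finite_same_card_bij fin card by blast
  have "card (V - (e \<union> f)) = card (V - (e' \<union> f'))"
    using sub fin card disj by (simp add: card_Diff_subset card_Un_disjoint)
  then obtain h where h: "bij_betw h (V - (e \<union> f)) (V - (e' \<union> f'))"
    using finite_same_card_bij V by (metis finite_Diff)
  define g where "g x = (if x \<in> e \<union> f then if x \<in> e then g\<^sub>e x else g\<^sub>f x else h x)" for x
  have "bij_betw g (e \<union> f \<union> (V - (e \<union> f))) (e' \<union> f' \<union> (V - (e' \<union> f')))"
    unfolding g_def by (intro bij_betw_disjoint_Un g\<^sub>e g\<^sub>f h) (use disj in auto)
  then have "bij_betw g V V" using sub by (simp add: Un_absorb1)
  moreover have "g ` e = g\<^sub>e ` e" by (auto simp: g_def)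
  moreover have "g ` f = g\<^sub>f ` f" using disj(1) by (auto simp: g_def)
  ultimately show thesis using that g\<^sub>e g\<^sub>f by (simp add: bij_betw_imp_surj_on)
qed

lemma in_dir_image_iff:
  assumes g: "inj_on g V" and r: "r \<subseteq> V \<times> V" and "x \<in> V" "y \<in> V"
  shows "(g x, g y) \<in> dir_image r g \<longleftrightarrow> (x, y) \<in> r"
  using assms by (auto simp: dir_image_def dest: inj_onD)

lemma linear_order_on_dir_image:
  assumes g: "bij_betw g V W" and r: "linear_order_on V r"
  shows "linear_order_on W (dir_image r g)"
proof -
  have "Field r = V" using r by (auto simp: order_on_defs Field_def refl_on_def)
  then show ?thesis
    using Linear_order_dir_image[of r g] r g by (simp add: dir_image_Field bij_betw_def)
qed

lemma separates_dir_image: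
  assumes g: "inj_on g V" and r: "r \<subseteq> V \<times> V" and sub: "e \<subseteq> V" "f \<subseteq> V"
  shows "separates (dir_image r g) (g ` e) (g ` f) \<longleftrightarrow> separates r e f"
proof -
  have "all_precede (dir_image r g) (g ` A) (g ` B) \<longleftrightarrow> all_precede r A B" if "A \<subseteq> V" "B \<subseteq> V" for A B
    using that in_dir_image_iff[OF g r] inj_on_eq_iff[OF g]
    by (simp add: all_precede_def subset_iff)
  then show ?thesis using sub by (simp add: separates_def)
qed

definition separating_orders :: "'a set \<Rightarrow> 'a set \<Rightarrow> 'a set \<Rightarrow> ('a \<times> 'a) set set" where
  "separating_orders V e f = {r. linear_order_on V r \<and> separates r e f}"

lemma finite_separating_orders: "finite V \<Longrightarrow> finite (separating_orders V e f)"
  by (rule finite_subset[OF _ finite_linear_orders]) (auto simp: separating_orders_def)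

lemma card_separating_orders_le:
  assumes V: "finite V" and ef: "e \<in> vertex_pairs V" "f \<in> vertex_pairs V" "e \<inter> f = {}"
    and ef': "e' \<in> vertex_pairs V" "f' \<in> vertex_pairs V" "e' \<inter> f' = {}"
  shows "card (separating_orders V e f) \<le> card (separating_orders V e' f')"
proof -
  obtain g where g: "bij_betw g V V" "g ` e = e'" "g ` f = f'"
    using exists_bij_betw_disjoint_images[OF V, of e f e' f'] ef ef' by (auto simp: vertex_pairs_def)
  then have inj: "inj_on g V" by (simp add: bij_betw_def)
  show ?thesis
  proof (rule card_inj_on_le[OF _ _ finite_separating_orders[OF V]])
    show "inj_on (\<lambda>r. dir_image r g) (separating_orders V e f)"
    proof (rule inj_onI)
      fix r s assume "r \<in> separating_orders V e f" "s \<in> separating_orders V e f"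
        and eq: "dir_image r g = dir_image s g"
      then have r: "linear_order_on V r" and s: "linear_order_on V s"
        by (auto simp: separating_orders_def)
      show "r = s"
      proof (rule linear_order_on_eqI[OF r s])
        fix x y assume xy: "x \<in> V" "y \<in> V"
        show "(x, y) \<in> r \<longleftrightarrow> (x, y) \<in> s"
          using in_dir_image_iff[OF inj linear_order_on_subset[OF r] xy]
            in_dir_image_iff[OF inj linear_order_on_subset[OF s] xy] eq by simp
      qed
    qed
    have "separates (dir_image r g) e' f'" if "linear_order_on V r" "separates r e f" for r
      using separates_dir_image[OF inj linear_order_on_subset, of r e f] that ef(1,2) g(2,3)
      by (auto simp: vertex_pairs_def)
    then show "(\<lambda>r. dir_image r g) ` separating_orders V e f \<subseteq> separating_orders V e' f'"
      using linear_order_on_dir_image[OF g(1)] by (auto simp: separating_orders_def)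
  qed
qed

lemma card_separating_orders_eq:
  assumes "finite V" "e \<in> vertex_pairs V" "f \<in> vertex_pairs V" "e \<inter> f = {}"
    and "e' \<in> vertex_pairs V" "f' \<in> vertex_pairs V" "e' \<inter> f' = {}"
  shows "card (separating_orders V e f) = card (separating_orders V e' f')"
  using assms by (intro le_antisym card_separating_orders_le)

lemma card_separating_orders_pos:
  assumes V: "finite V" and ef: "e \<in> vertex_pairs V" "f \<in> vertex_pairs V" "e \<inter> f = {}"
  shows "card (separating_orders V e f) > 0"
proof -
  obtain a b c d where abcd: "e = {a, b}" "f = {c, d}" "distinct [a, b, c, d]" "{a, b, c, d} \<subseteq> V"
    using disjoint_vertex_pairsE[OF ef] .
  obtain r where r: "linear_order_on V r"
    using Zorn.well_order_on[of V] by (auto simp: well_order_on_def)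
  have "separates r {a, b} {c, d} \<or> separates r {a, c} {d, b} \<or> separates r {a, d} {b, c}"
    using separates_three_matchings[OF V r abcd(4,3)] by (auto simp: of_bool_def split: if_splits)
  then obtain e' f' where ef': "e' \<in> vertex_pairs V" "f' \<in> vertex_pairs V" "e' \<inter> f' = {}" "separates r e' f'"
    using abcd(3,4) by (elim disjE) (rule that; auto)+
  then have "r \<in> separating_orders V e' f'" using r by (simp add: separating_orders_def)
  then have "card (separating_orders V e' f') > 0"
    using finite_separating_orders[OF V] by (auto simp: card_gt_0_iff)
  then show ?thesis using card_separating_orders_eq[OF V ef ef'(1-3)] by simp
qed

lemma exists_perfect_separating_family:
  assumes V: "finite V" and E: "E \<subseteq> vertex_pairs V"
  shows "\<exists>F. perfect_separating_family V E F"
proof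
  let ?F = "mset_set {r. linear_order_on V r}"
  have fin: "finite {r. linear_order_on V r}" by (rule finite_linear_orders[OF V])
  have size: "size (filter_mset (\<lambda>r. separates r e f) ?F) = card (separating_orders V e f)" for e f
    using fin by (simp add: separating_orders_def)
  have pos: "card (separating_orders V e f) > 0" if "e \<in> E" "f \<in> E" "e \<inter> f = {}" for e f
    using card_separating_orders_pos[OF V] that E by blast
  have "separating_family V E ?F"
    using pos fin by (auto simp: separating_family_def separating_orders_def card_gt_0_iff)
  moreover have "\<exists>l>0. \<forall>e\<in>E. \<forall>f\<in>E. e \<inter> f = {} \<longrightarrow> card (separating_orders V e f) = l"
  proof (cases "\<exists>e\<in>E. \<exists>f\<in>E. e \<inter> f = {}")
    case True
    then obtain e f where ef: "e \<in> E" "f \<in> E" "e \<inter> f = {}" by blast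
    have "card (separating_orders V e' f') = card (separating_orders V e f)"
      if "e' \<in> E" "f' \<in> E" "e' \<inter> f' = {}" for e' f'
      using card_separating_orders_eq[OF V] that ef E by blast
    then show ?thesis using pos[OF ef] by blast
  qed auto
  ultimately show "perfect_separating_family V E ?F"
    unfolding perfect_separating_family_def size by blast
qed

lemma perfect_separating_family_PSD:
  assumes "finite V" "E \<subseteq> vertex_pairs V"
  shows "\<exists>F. perfect_separating_family V E F \<and> size F = PSD V E"
  using LeastI_ex[of "\<lambda>k. \<exists>F. perfect_separating_family V E F \<and> size F = k"]
    exists_perfect_separating_family[OF assms] unfolding PSD_def by blast

text \<open>For a graph without disjoint edges, the number \<open>l\<close> in the definition of a perfect family
  can be arbitrarily large.\<close>

lemma perfect_separating_family_independent:
  assumes "perfect_separating_family V E F"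
  shows "\<exists>l\<in>{1..Suc (size F)}. E \<in> independent_sets (conflicts V F l)"
proof -
  obtain l where l: "l > 0" "\<And>e f. e \<in> E \<Longrightarrow> f \<in> E \<Longrightarrow> e \<inter> f = {} \<Longrightarrow> separation_count F e f = l"
    using assms unfolding perfect_separating_family_def separation_count_def by blast
  have "separation_count F e f = min l (Suc (size F))" if "e \<in> E" "f \<in> E" "e \<inter> f = {}" for e f
    using l(2)[OF that] separation_count_le_size[of F e f] by simp
  then have "E \<in> independent_sets (conflicts V F (min l (Suc (size F))))"
    by (auto simp: independent_sets_def conflicts_def)
  then show ?thesis using l(1) by (intro bexI[of _ "min l (Suc (size F))"]) auto
qed

subsection \<open>The union bound\<close>

lemma
  assumes "finite A"
  shows finite_multisets_size_eq: "finite {M. set_mset M \<subseteq> A \<and> size M = k}"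
    and card_multisets_size_eq_le: "card {M. set_mset M \<subseteq> A \<and> size M = k} \<le> card A ^ k"
proof -
  have "{M. set_mset M \<subseteq> A \<and> size M = k} \<subseteq> mset ` {xs. set xs \<subseteq> A \<and> length xs = k}"
  proof
    fix M assume "M \<in> {M. set_mset M \<subseteq> A \<and> size M = k}"
    moreover obtain xs where "M = mset xs" by (metis ex_mset)
    ultimately show "M \<in> mset ` {xs. set xs \<subseteq> A \<and> length xs = k}" by auto
  qed
  then show "finite {M. set_mset M \<subseteq> A \<and> size M = k}"
    and "card {M. set_mset M \<subseteq> A \<and> size M = k} \<le> card A ^ k"
    using finite_lists_length_eq[OF assms, of k] card_lists_length_eq[OF assms, of k]
    by (auto intro: finite_subset dest: surj_card_le[rotated])
qed

definition order_families :: "'a set \<Rightarrow> nat \<Rightarrow> ('a \<times> 'a) set multiset set" where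
  "order_families V k = {F. set_mset F \<subseteq> {r. linear_order_on V r} \<and> size F = k}"

lemma finite_order_families: "finite V \<Longrightarrow> finite (order_families V k)"
  unfolding order_families_def by (intro finite_multisets_size_eq finite_linear_orders)

lemma card_order_families_le:
  assumes "finite V"
  shows "card (order_families V k) \<le> (card V ^ card V) ^ k"
proof -
  have "card (order_families V k) \<le> card {r. linear_order_on V r} ^ k"
    unfolding order_families_def by (rule card_multisets_size_eq_le[OF finite_linear_orders[OF assms]])
  also have "\<dots> \<le> (card V ^ card V) ^ k"
    using card_linear_orders_le[OF assms] by (rule power_mono) simp
  finally show ?thesis .
qed

lemma exists_independent_PSD:
  assumes "finite V" "E \<subseteq> vertex_pairs V"
  shows "\<exists>F\<in>order_families V (PSD V E). \<exists>l\<in>{1..Suc (PSD V E)}. E \<in> independent_sets (conflicts V F l)"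
proof -
  obtain F where F: "perfect_separating_family V E F" "size F = PSD V E"
    using perfect_separating_family_PSD[OF assms] by blast
  then have "F \<in> order_families V (PSD V E)"
    by (auto simp: order_families_def perfect_separating_family_def separating_family_def)
  then show ?thesis using perfect_separating_family_independent[OF F(1)] F(2) by auto
qed

lemma prob_PSD_eq_le:
  fixes p :: real and V :: "'a set"
  assumes V: "finite V" and p: "0 < p" "p \<le> 1"
  defines "n \<equiv> card V"
  assumes n: "100 \<le> n" "200 * k \<le> n"
  shows "measure_pmf.prob (random_subset_pmf (vertex_pairs V) p) {E. PSD V E = k}
    \<le> real ((n ^ n) ^ k * Suc k) * exp (real n / 8 - 0.0046 * ((real n)\<^sup>2 * p))"
proof -
  let ?M = "random_subset_pmf (vertex_pairs V) p" and ?I = "order_families V k \<times> {1..Suc k}"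
    and ?c = "exp (real n / 8 - 0.0046 * ((real n)\<^sup>2 * p))"
  define indep where "indep = (\<lambda>(F, l). independent_sets (conflicts V F l))"
  have card_I: "card ?I \<le> (n ^ n) ^ k * Suc k"
    unfolding card_cartesian_product n_def by (intro mult_le_mono card_order_families_le V) simp
  have "measure_pmf.prob ?M {E. PSD V E = k} = measure_pmf.prob ?M ({E. PSD V E = k} \<inter> Pow (vertex_pairs V))"
    by (rule prob_random_subset_pmf_cong) auto
  also have "\<dots> \<le> measure_pmf.prob ?M (\<Union>q\<in>?I. indep q)"
  proof (rule measure_pmf.finite_measure_mono)
    show "{E. PSD V E = k} \<inter> Pow (vertex_pairs V) \<subseteq> (\<Union>q\<in>?I. indep q)"
      using exists_independent_PSD[OF V] by (fastforce simp: indep_def)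
  qed simp
  also have "\<dots> \<le> (\<Sum>q\<in>?I. measure_pmf.prob ?M (indep q))"
    using finite_order_families[OF V] by (intro measure_pmf.finite_measure_subadditive_finite) auto
  also have "\<dots> \<le> (\<Sum>q\<in>?I. ?c)"
  proof (intro sum_mono)
    fix q assume "q \<in> ?I"
    then obtain F l where q: "q = (F, l)" and F: "F \<in> order_families V k" and l: "l > 0" by auto
    interpret order_family V F
      by unfold_locales (use V F in \<open>auto simp: order_families_def\<close>)
    show "measure_pmf.prob ?M (indep q) \<le> ?c"
      using prob_independent_conflicts_le[OF p _ _ l] n F by (simp add: q indep_def n_def order_families_def)
  qed
  also have "\<dots> \<le> real ((n ^ n) ^ k * Suc k) * ?c"
    unfolding sum_constant using card_I by (intro mult_right_mono of_nat_mono) auto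
  finally show ?thesis .
qed

lemma order_family_count_le_exp:
  fixes p :: real
  assumes n: "2 \<le> n" and k: "real k < real n * p / (200 * log 2 n)" and p: "0 < p"
  shows "real ((n ^ n) ^ k) \<le> exp (0.0035 * ((real n)\<^sup>2 * p))"
proof -
  have ln: "ln (real n) > 0" using n by simp
  have "real k * (real n * ln n) \<le> real n * p / (200 * log 2 n) * (real n * ln n)"
    using k ln by (intro mult_right_mono) auto
  also have "\<dots> = ln 2 / 200 * ((real n)\<^sup>2 * p)"
    using ln by (simp add: log_def field_simps power2_eq_square)
  also have "\<dots> \<le> 0.0035 * ((real n)\<^sup>2 * p)"
    using ln2_le_25_over_36 p by (intro mult_right_mono) auto
  finally have exponent: "real k * (real n * ln n) \<le> 0.0035 * ((real n)\<^sup>2 * p)" .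
  have "real ((n ^ n) ^ k) = exp (ln n) ^ (n * k)" using n by (simp add: power_mult)
  also have "\<dots> = exp (real k * (real n * ln n))"
    by (simp add: exp_of_nat_mult[symmetric] mult_ac)
  finally show ?thesis using exponent by simp
qed

lemma gnp_pmf_eq: "gnp_pmf n p = random_subset_pmf (vertex_pairs {..<n}) p"
  by (simp add: gnp_pmf_def random_subset_pmf_def)

lemma powr_le_square_mult:
  fixes x p a :: real
  assumes "0 < x" "x powr a \<le> p"
  shows "x powr (2 + a) \<le> x\<^sup>2 * p"
  using assms by (simp add: powr_add powr_realpow mult_left_mono)

lemma prob_PSD_less_le:
  fixes p :: real
  assumes n: "100 \<le> n" and p: "real n powr (-0.4) \<le> p" "p < 1"
  shows "measure_pmf.prob (gnp_pmf n p) {E. real (PSD {..<n} E) < real n * p / (200 * log 2 n)}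
    \<le> real n ^ 2 * exp (real n / 8 - 0.0011 * real n powr 1.6)"
proof -
  let ?M = "gnp_pmf n p"
  define b where "b = real n * p / (200 * log 2 n)"
  define c where "c = exp (real n / 8 - 0.0046 * ((real n)\<^sup>2 * p))"
  have p_pos: "0 < p" using p(1) n by (intro less_le_trans[OF _ p(1)]) simp
  have "b \<le> real n / (200 * 1)"
    unfolding b_def using n p by (intro frac_le mult_left_mono mult_left_le) (auto simp: le_log_iff)
  then have small: "200 * k \<le> n" "k < n" if "real k < b" for k
    using that n by linarith+
  then have K: "{k. real k < b} \<subseteq> {..<n}" by auto
  then have finK: "finite {k. real k < b}" by (rule finite_subset) simp
  have "measure_pmf.prob ?M {E. real (PSD {..<n} E) < b} =
      measure_pmf.prob ?M (\<Union>k\<in>{k. real k < b}. {E. PSD {..<n} E = k})"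
    by (intro arg_cong[of _ _ "measure_pmf.prob ?M"]) auto
  also have "\<dots> \<le> (\<Sum>k | real k < b. measure_pmf.prob ?M {E. PSD {..<n} E = k})"
    by (intro measure_pmf.finite_measure_subadditive_finite finK) simp
  also have "\<dots> \<le> (\<Sum>k | real k < b. exp (0.0035 * ((real n)\<^sup>2 * p)) * n * c)"
  proof (intro sum_mono)
    fix k assume "k \<in> {k. real k < b}"
    then have k: "real k < b" by simp
    have "measure_pmf.prob ?M {E. PSD {..<n} E = k} \<le> real ((n ^ n) ^ k * Suc k) * c"
      using prob_PSD_eq_le[of "{..<n}" p k] p p_pos n small[OF k]
      unfolding gnp_pmf_eq c_def card_lessThan by simp
    also have "\<dots> = real ((n ^ n) ^ k) * real (Suc k) * c" by (simp only: of_nat_mult)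
    also have "\<dots> \<le> exp (0.0035 * ((real n)\<^sup>2 * p)) * n * c"
      using order_family_count_le_exp[of n k p] k small[OF k] n p_pos
      by (intro mult_mono) (auto simp: b_def c_def)
    finally show "measure_pmf.prob ?M {E. PSD {..<n} E = k} \<le> exp (0.0035 * ((real n)\<^sup>2 * p)) * n * c" .
  qed
  also have "\<dots> \<le> real n * (exp (0.0035 * ((real n)\<^sup>2 * p)) * n * c)"
    unfolding sum_constant using card_mono[OF _ K] by (intro mult_right_mono) (auto simp: c_def)
  also have "\<dots> = real n ^ 2 * exp (real n / 8 - 0.0011 * ((real n)\<^sup>2 * p))"
    by (simp add: c_def exp_add[symmetric] power2_eq_square algebra_simps)
  also have "\<dots> \<le> real n ^ 2 * exp (real n / 8 - 0.0011 * real n powr 1.6)"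
    using powr_le_square_mult[of "real n" "-0.4" p] p(1) n by (intro mult_left_mono) auto
  finally show ?thesis unfolding b_def .
qed

theorem theorem2:
  fixes p :: "nat \<Rightarrow> real"
  assumes "\<And>n. n \<ge> 2 \<Longrightarrow> real n powr (-0.4) \<le> p n \<and> p n < 1"
  shows "(\<lambda>n. measure_pmf.prob (gnp_pmf n (p n))
            {E. real (PSD {..<n} E) \<ge> real n * p n / (200 * log 2 (real n))})
         \<longlonglongrightarrow> 1"
proof (rule tendsto_sandwich)
  show "(\<lambda>n. 1 - real n ^ 2 * exp (real n / 8 - 0.0011 * real n powr 1.6)) \<longlonglongrightarrow> 1"
    by real_asymp
  show "\<forall>\<^sub>F n in sequentially. 1 - real n ^ 2 * exp (real n / 8 - 0.0011 * real n powr 1.6)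
      \<le> measure_pmf.prob (gnp_pmf n (p n))
            {E. real (PSD {..<n} E) \<ge> real n * p n / (200 * log 2 (real n))}"
    using eventually_ge_at_top[of 100]
  proof eventually_elim
    case (elim n)
    let ?small = "{E. real (PSD {..<n} E) < real n * p n / (200 * log 2 (real n))}"
    have "measure_pmf.prob (gnp_pmf n (p n)) ?small
        \<le> real n ^ 2 * exp (real n / 8 - 0.0011 * real n powr 1.6)"
      using assms[of n] elim by (intro prob_PSD_less_le) auto
    moreover have "{E. real (PSD {..<n} E) \<ge> real n * p n / (200 * log 2 (real n))} = UNIV - ?small"
      by auto
    ultimately show ?case
      using measure_pmf.prob_compl[of ?small "gnp_pmf n (p n)"] by simp
  qed
qed auto

end
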